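(* Let $G$ be a countable amenable group and let $(X,\mu,G,\varphi)$ be a multiordered dynamical system, i.e. a measure-preserving action $(X,\mu,G)$ on a standard probability space together with a fixed measure-theoretic factor map $\varphi:(X,\mu,G)\to(\tilde{\mathcal O},\nu,G)$ to a multiorder. Let $S:X\to X$ denote the successor map $S(x)=g(x)$, where $g=1^{\prec}$ and $\prec\,=\varphi(x)$. Then, for every finite measurable partition $\mathcal P$ of $X$, $$h(\mu,G,\mathcal P\,|\,\Sigma_{\tilde{\mathcal O}})=h(\mu,S,\mathcal P\,|\,\Sigma_{\tilde{\mathcal O}}),$$ where the left side is the conditional entropy, with respect to $\Sigma_{\tilde{\mathcal O}}$, of the process generated by $\mathcal P$ under the action of $G$, and the right side is the analogous conditional entropy of the process generated by $\mathcal P$ under the $\mathbb Z$-action given by the iterates of $S$.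
   Context: A countable amenable group means an infinite countable discrete group $G$ (unit $e$) in which there is a Følner sequence, i.e. a sequence of finite subsets $F_n\subset G$ with $\lim_n |F_n\cap gF_n|/|F_n|=1$ for every $g\in G$. A linear order $\prec$ on $G$ is of type $\mathbb Z$ if every order interval $[a,b]^{\prec}=\{a,b\}\cup\{g\in G: a\prec g\prec b\}$ ($a\prec b$) is finite and $G$ has no minimal or maximal element. The set $\tilde{\mathcal O}$ of all orders of type $\mathbb Z$ on $G$ is a Borel subset of $\{0,1\}^{G\times G}$ (relations identified with their indicator functions, product topology), with the inherited Borel sigma-algebra. $G$ acts on $\tilde{\mathcal O}$ by: $\prec'=g(\prec)$ where $a\prec' b\iff ag\prec bg$. A multiorder on $G$ is the measure-preserving action $(\tilde{\mathcal O},\nu,G)$, where $\nu$ is a $G$-invariant Borel probability measure on $\tilde{\mathcal O}$. For $\prec\,\in\tilde{\mathcal O}$, $i\mapsto i^{\prec}$ denotes the unique bijection $\mathbb Z\to G$ such that $0^{\prec}=e$ and $(i+1)^{\prec}$ is the successor of $i^{\prec}$ for all $i$; thus $1^{\prec}$ is the successor of $e$. $\Sigma_{\tilde{\mathcal O}}$ is the sub-sigma-algebra on $X$ consisting of the $\varphi$-preimages of Borel subsets of $\tilde{\mathcal O}$. It is a known preliminary fact that $S$ is an invertible $\mu$-preserving map with the same orbits as $G$ (a.e.), and that $\Sigma_{\tilde{\mathcal O}}$ is invariant under both $G$ and $S$. Entropy: $H(\mu,\mathcal P)=-\sum_{P\in\mathcal P}\mu(P)\log\mu(P)$; for a sub-sigma-algebra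 $\Theta$, $H(\mu,\mathcal P|\Theta)=\inf_{\mathcal Q}\bigl(H(\mu,\mathcal P\vee\mathcal Q)-H(\mu,\mathcal Q)\bigr)$ over finite $\Theta$-measurable partitions $\mathcal Q$; for finite $D\subset G$, $\mathcal P^D=\bigvee_{g\in D}g^{-1}(\mathcal P)$; for $G$-invariant $\Theta$, $h(\mu,G,\mathcal P|\Theta)=\lim_n\frac1{|F_n|}H(\mu,\mathcal P^{F_n}|\Theta)$ for any Følner sequence $(F_n)$. The quantity $h(\mu,S,\mathcal P|\Theta)$ is the same notion for the $\mathbb Z$-action generated by $S$. *)

theory Defs
  imports "HOL-Probability.Probability"
begin

text \<open>
  Groups are types of class \<open>group_add\<close>. Addition in this class is not assumed to be commutative:
  \<open>g + h\<close> stands for the product \<open>gh\<close>, \<open>0\<close> for the unit and \<open>- g\<close> for the inverse. The group of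
  integers is the instance \<open>int\<close>.
\<close>

section \<open>Amenability\<close>

definition folner :: "(nat \<Rightarrow> 'g::group_add set) \<Rightarrow> bool" where
  "folner F \<longleftrightarrow>
     (\<forall>n. finite (F n)) \<and>
     (\<forall>g. (\<lambda>n. real (card (F n \<inter> (\<lambda>h. g + h) ` F n)) / real (card (F n))) \<longlonglongrightarrow> 1)"

definition amenable :: "'g::group_add itself \<Rightarrow> bool" where
  "amenable _ \<longleftrightarrow> (\<exists>F :: nat \<Rightarrow> 'g set. folner F)"

section \<open>Measure-preserving actions\<close>

definition standard_borel :: "'x measure \<Rightarrow> bool" where
  "standard_borel M \<longleftrightarrow>
     (\<exists>X. completely_metrizable_space X \<and> second_countable X \<and>
          space M = topspace X \<and> sets M = sigma_sets (topspace X) {U. openin X U})"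

text \<open>Both usual conventions are admitted: a Borel probability measure or its completion.\<close>

definition standard_prob_space :: "'x measure \<Rightarrow> bool" where
  "standard_prob_space M \<longleftrightarrow>
     prob_space M \<and> (\<exists>N. standard_borel N \<and> (M = N \<or> M = completion N))"

definition measure_preserving :: "'x measure \<Rightarrow> 'y measure \<Rightarrow> ('x \<Rightarrow> 'y) \<Rightarrow> bool" where
  "measure_preserving M N f \<longleftrightarrow> f \<in> measurable M N \<and> distr M N f = N"

definition mp_action :: "'x measure \<Rightarrow> ('g::group_add \<Rightarrow> 'x \<Rightarrow> 'x) \<Rightarrow> bool" where
  "mp_action M T \<longleftrightarrow>
     (\<forall>g. measure_preserving M M (T g)) \<and>
     (\<forall>x\<in>space M. T 0 x = x) \<and>
     (\<forall>g h. \<forall>x\<in>space M. T (g + h) x = T g (T h x))"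

definition factor_map ::
  "'x measure \<Rightarrow> ('g::group_add \<Rightarrow> 'x \<Rightarrow> 'x) \<Rightarrow>
   'y measure \<Rightarrow> ('g \<Rightarrow> 'y \<Rightarrow> 'y) \<Rightarrow> ('x \<Rightarrow> 'y) \<Rightarrow> bool" where
  "factor_map M T N U \<phi> \<longleftrightarrow>
     measure_preserving M N \<phi> \<and> (AE x in M. \<forall>g. \<phi> (T g x) = U g (\<phi> x))"

section \<open>Multiorders\<close>

definition order_interval :: "('g \<Rightarrow> 'g \<Rightarrow> bool) \<Rightarrow> 'g \<Rightarrow> 'g \<Rightarrow> 'g set" where
  "order_interval R a b = {a, b} \<union> {g. R a g \<and> R g b}"

definition orders_Z :: "('g \<Rightarrow> 'g \<Rightarrow> bool) set" where
  "orders_Z = {R. irreflp R \<and> transp R \<and> totalp R \<and>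
                  (\<forall>a b. R a b \<longrightarrow> finite (order_interval R a b)) \<and>
                  (\<forall>a. \<exists>b. R b a) \<and> (\<forall>a. \<exists>b. R a b)}"

text \<open>
  Relations are curried indicator functions, \<open>bool\<close> is discrete and function types carry the
  product topology, so \<open>borel\<close> below is the Borel sigma-algebra of \<open>{0,1}\<close> to the power
  \<open>G \<times> G\<close>.
\<close>

definition orders_Z_borel :: "('g \<Rightarrow> 'g \<Rightarrow> bool) measure" where
  "orders_Z_borel = restrict_space borel orders_Z"

definition act_order :: "'g::group_add \<Rightarrow> ('g \<Rightarrow> 'g \<Rightarrow> bool) \<Rightarrow> 'g \<Rightarrow> 'g \<Rightarrow> bool" where
  "act_order g R = (\<lambda>a b. R (a + g) (b + g))"

definition multiorder :: "('g::group_add \<Rightarrow> 'g \<Rightarrow> bool) measure \<Rightarrow> bool" where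
  "multiorder \<nu> \<longleftrightarrow> prob_space \<nu> \<and> sets \<nu> = sets orders_Z_borel \<and> mp_action \<nu> act_order"

definition is_successor :: "('g \<Rightarrow> 'g \<Rightarrow> bool) \<Rightarrow> 'g \<Rightarrow> 'g \<Rightarrow> bool" where
  "is_successor R a b \<longleftrightarrow> R a b \<and> \<not> (\<exists>c. R a c \<and> R c b)"

definition order_enum :: "('g::group_add \<Rightarrow> 'g \<Rightarrow> bool) \<Rightarrow> int \<Rightarrow> 'g" where
  "order_enum R =
     (THE f. bij f \<and> f 0 = 0 \<and> (\<forall>i. is_successor R (f i) (f (i + 1))))"

definition successor_map ::
  "('g::group_add \<Rightarrow> 'x \<Rightarrow> 'x) \<Rightarrow> ('x \<Rightarrow> 'g \<Rightarrow> 'g \<Rightarrow> bool) \<Rightarrow> 'x \<Rightarrow> 'x" where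
  "successor_map T \<phi> x = T (order_enum (\<phi> x) 1) x"

definition orders_algebra ::
  "'x measure \<Rightarrow> ('x \<Rightarrow> 'g \<Rightarrow> 'g \<Rightarrow> bool) \<Rightarrow> 'x measure" where
  "orders_algebra M \<phi> = vimage_algebra (space M) \<phi> orders_Z_borel"

text \<open>
  Since \<open>\<phi>\<close> is equivariant only almost everywhere, the successor map is invertible only almost
  everywhere. Its inverse is determined up to a null set, on which no entropy below depends.
\<close>

definition ae_inverse :: "'x measure \<Rightarrow> ('x \<Rightarrow> 'x) \<Rightarrow> 'x \<Rightarrow> 'x" where
  "ae_inverse M S =
     (SOME S'. S' \<in> measurable M M \<and> (AE x in M. S' (S x) = x) \<and> (AE x in M. S (S' x) = x))"

definition iterates :: "'x measure \<Rightarrow> ('x \<Rightarrow> 'x) \<Rightarrow> int \<Rightarrow> 'x \<Rightarrow> 'x" where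
  "iterates M S i = (if 0 \<le> i then S ^^ nat i else ae_inverse M S ^^ nat (- i))"

section \<open>Entropy\<close>

text \<open>
  In \<open>finite_partition M \<Theta> P\<close> the measure \<open>\<Theta>\<close> only serves as a sub-sigma-algebra of \<open>M\<close>.
  Partitions have no empty members; these would not contribute to the entropy.
\<close>

definition finite_partition :: "'x measure \<Rightarrow> 'x measure \<Rightarrow> 'x set set \<Rightarrow> bool" where
  "finite_partition M \<Theta> P \<longleftrightarrow> finite P \<and> partition_on (space M) P \<and> P \<subseteq> sets \<Theta>"

definition partition_entropy :: "'x measure \<Rightarrow> 'x set set \<Rightarrow> real" where
  "partition_entropy M P = - (\<Sum>A\<in>P. measure M A * ln (measure M A))"

definition cond_partition_entropy ::
  "'x measure \<Rightarrow> 'x measure \<Rightarrow> 'x set set \<Rightarrow> real" where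
  "cond_partition_entropy M \<Theta> P =
     (INF Q\<in>{Q. finite_partition M \<Theta> Q}.
        partition_entropy M (common_refinement {P, Q}) - partition_entropy M Q)"

definition preimage_partition ::
  "'x measure \<Rightarrow> ('x \<Rightarrow> 'x) \<Rightarrow> 'x set set \<Rightarrow> 'x set set" where
  "preimage_partition M f P = {f -` A \<inter> space M |A. A \<in> P} - {{}}"

definition iterated_partition ::
  "'x measure \<Rightarrow> ('g \<Rightarrow> 'x \<Rightarrow> 'x) \<Rightarrow> 'x set set \<Rightarrow> 'g set \<Rightarrow> 'x set set" where
  "iterated_partition M T P D = common_refinement ((\<lambda>g. preimage_partition M (T g) P) ` D)"

text \<open>The common value of the limit along all Folner sequences of the acting group.\<close>

definition cond_entropy_rate ::
  "'x measure \<Rightarrow> ('g::group_add \<Rightarrow> 'x \<Rightarrow> 'x) \<Rightarrow> 'x measure \<Rightarrow> 'x set set \<Rightarrow> real" where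
  "cond_entropy_rate M T \<Theta> P =
     (THE h. \<forall>F. folner F \<longrightarrow>
        (\<lambda>n. cond_partition_entropy M \<Theta> (iterated_partition M T P (F n)) / real (card (F n)))
          \<longlonglongrightarrow> h)"

end

theory Submission
  imports Defs "HOL-Real_Asymp.Real_Asymp"
begin

text \<open>
  Conditioning on the order \<open>r = \<phi> x\<close>, the chain rule along \<open>r\<close> writes the entropy of the
  names of \<open>P\<close> over a finite \<open>D \<subseteq> G\<close> as a sum, over \<open>g \<in> D\<close>, of the conditional entropy of the
  coordinate \<open>g\<close> given those coordinates of \<open>D\<close> that precede \<open>g\<close> in \<open>r\<close>. By equivariance,
  after integration the term of \<open>g\<close> becomes the entropy of \<open>P\<close> given the part of \<open>D - g\<close> that lies
  in the past of the unit. For most \<open>g\<close> in a Folner set the set \<open>D - g\<close> contains any prescribed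
  finite set, so the averages converge to the entropy of \<open>P\<close> given the whole past of the unit. The
  same argument applies to the iterates of the successor map, which move \<open>x\<close> along the enumeration
  of \<open>\<phi> x\<close>; the past of the unit is the same random set for both actions, hence so is the limit.
\<close>

section \<open>Shannon entropy of finite families\<close>

text \<open>The order along which the chain rule runs varies with the point, so the rule cannot be
  applied to partitions of the whole space. Hence the infimum over finite partitions is turned into
  an integral over \<open>\<nu>\<close> of entropies in the fibres
  (\<open>cond_partition_entropy_eq_integral\<close>), where \<open>r\<close> is one fixed order. A
  fibre carries no measure here: every event has its own version of the conditional probability, and
  since there are only countably many cells, almost every \<open>r\<close> makes their masses
  consistent, which is all that \<open>marginals\<close> asks. Likewise the infinite past is never
  conditioned on: entropies given finite sets decrease as the set grows, and the limit stands for
  the past. Windows of group elements and windows of positions in the order give the same limit,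
  since each finite piece of the past obtained in one way lies in a piece obtained in the other. The
  sides of the translations fit together: \<open>k\<close> has the form \<open>d - g\<close> with
  \<open>d \<in> F n\<close> iff \<open>k + g \<in> F n\<close>, so right translates by
  \<open>- g\<close> are controlled by left Folner invariance.\<close>

definition eta :: "real \<Rightarrow> real" where
  "eta x = - (x * ln x)"

lemma eta_0 [simp]: "eta 0 = 0" and eta_1 [simp]: "eta 1 = 0"
  by (simp_all add: eta_def)

text \<open>Concavity: the right side is the tangent of \<open>eta\<close> at \<open>t\<close>. All
  entropy inequalities below come from a suitable choice of \<open>t\<close>.\<close>

lemma eta_le_tangent:
  assumes "0 \<le> x" "0 < t"
  shows "eta x \<le> - x * ln t + t - x"
proof (cases "x = 0")
  case False
  with assms have x: "0 < x" by simp
  have "ln (t / x) \<le> t / x - 1"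
    using assms x by (intro ln_le_minus_one) simp
  then have "x * ln (t / x) \<le> x * (t / x - 1)"
    using x by simp
  then show ?thesis
    using assms x by (simp add: eta_def ln_div algebra_simps)
qed (use assms in simp)

lemma eta_le_1: "0 \<le> x \<Longrightarrow> eta x \<le> 1"
  using eta_le_tangent[of x 1] by simp

lemma eta_nonneg: "0 \<le> x \<Longrightarrow> x \<le> 1 \<Longrightarrow> 0 \<le> eta x"
  by (cases "x = 0") (auto simp: eta_def mult_nonneg_nonpos)

text \<open>Only the endpoint 0 is delicate, where \<open>x * ln x\<close> tends to 0. On the
  compact interval this yields the uniform modulus used in
  \<open>cond_partition_entropy_eq_integral\<close>.\<close>

lemma continuous_on_eta: "continuous_on {0..1} eta"
proof -
  have "(eta \<longlongrightarrow> eta x) (at x within {0..1})" if x: "x \<in> {0..1}" for x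
  proof (cases "x = 0")
    case True
    have "((\<lambda>x::real. - (x * ln x)) \<longlongrightarrow> 0) (at_right 0)"
      by real_asymp
    then have "(eta \<longlongrightarrow> 0) (at 0 within {0<..})"
      by (simp add: eta_def[abs_def])
    then have "(eta \<longlongrightarrow> 0) (at 0 within {0..1})"
    proof (rule tendsto_mono[rotated])
      have "at (0::real) within {0..1} = at 0 within ({0..1} - {0})"
        by (metis at_within_def Diff_idemp)
      also have "\<dots> \<le> at_right 0"
        by (rule at_le) auto
      finally show "at (0::real) within {0..1} \<le> at_right 0" .
    qed
    with True show ?thesis by simp
  next
    case False
    then have "isCont eta x"
      unfolding eta_def[abs_def] by (intro continuous_intros) auto
    then show ?thesis
      using continuous_at_imp_continuous_at_within continuous_within by blast
  qed
  then show ?thesis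
    by (auto simp: continuous_on_def)
qed

lemma borel_measurable_eta [measurable]: "eta \<in> borel_measurable borel"
  unfolding eta_def[abs_def] by measurable

lemma eta_sum_le:
  assumes "finite A" "\<And>a. a \<in> A \<Longrightarrow> 0 \<le> p a"
  shows "eta (\<Sum>a\<in>A. p a) \<le> (\<Sum>a\<in>A. eta (p a))"
proof -
  have "p a * ln (p a) \<le> p a * ln (\<Sum>a\<in>A. p a)" if a: "a \<in> A" for a
  proof (cases "p a = 0")
    case False
    with assms a have "0 < p a" by (simp add: less_le)
    moreover have "p a \<le> (\<Sum>a\<in>A. p a)"
      using assms a by (intro member_le_sum) auto
    ultimately show ?thesis by simp
  qed simp
  then have "(\<Sum>a\<in>A. p a * ln (p a)) \<le> (\<Sum>a\<in>A. p a * ln (\<Sum>a\<in>A. p a))"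
    by (rule sum_mono)
  then show ?thesis
    by (simp add: eta_def sum_negf sum_distrib_right)
qed

text \<open>Nonnegativity of mutual information, for a matrix of masses that need not sum to 1. The
  tangent is taken at the product weights \<open>r a * c b / s\<close>; these have the same total
  \<open>s\<close> as the matrix, so the terms outside the logarithms cancel in the sum.\<close>

lemma eta_sum_submodular:
  assumes "finite A" "finite B" and p: "\<And>a b. a \<in> A \<Longrightarrow> b \<in> B \<Longrightarrow> 0 \<le> p a b"
  shows "(\<Sum>a\<in>A. \<Sum>b\<in>B. eta (p a b)) + eta (\<Sum>a\<in>A. \<Sum>b\<in>B. p a b)
    \<le> (\<Sum>a\<in>A. eta (\<Sum>b\<in>B. p a b)) + (\<Sum>b\<in>B. eta (\<Sum>a\<in>A. p a b))"
proof -
  define r where "r a = (\<Sum>b\<in>B. p a b)" for a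
  define c where "c b = (\<Sum>a\<in>A. p a b)" for b
  define s where "s = (\<Sum>a\<in>A. r a)"
  have s': "s = (\<Sum>b\<in>B. c b)"
    unfolding s_def r_def c_def by (rule sum.swap)
  have r0: "0 \<le> r a" if "a \<in> A" for a
    using that p by (auto simp: r_def intro: sum_nonneg)
  have c0: "0 \<le> c b" if "b \<in> B" for b
    using that p by (auto simp: c_def intro: sum_nonneg)
  have *: "eta (p a b) \<le> - p a b * ln (r a) - p a b * ln (c b) + p a b * ln s + r a * c b / s - p a b"
    if ab: "a \<in> A" "b \<in> B" for a b
  proof (cases "p a b = 0")
    case True
    have "0 \<le> s" using r0 by (auto simp: s_def intro: sum_nonneg)
    with True r0 c0 ab show ?thesis by simp
  next
    case False
    with p ab have pos: "0 < p a b" by (simp add: less_le)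
    have "p a b \<le> r a"
      unfolding r_def using assms ab by (intro member_le_sum[of b B "p a"]) auto
    moreover have "p a b \<le> c b"
      unfolding c_def using assms ab by (intro member_le_sum[of a A "\<lambda>a. p a b"]) auto
    moreover have "r a \<le> s"
      unfolding s_def using assms ab r0 by (intro member_le_sum) auto
    ultimately have "0 < r a" "0 < c b" "0 < s"
      using pos by auto
    then show ?thesis
      using eta_le_tangent[of "p a b" "r a * c b / s"] pos
      by (simp add: ln_div ln_mult algebra_simps)
  qed
  have "(\<Sum>a\<in>A. \<Sum>b\<in>B. eta (p a b)) \<le>
    (\<Sum>a\<in>A. \<Sum>b\<in>B. - p a b * ln (r a) - p a b * ln (c b) + p a b * ln s + r a * c b / s - p a b)"
    by (intro sum_mono *)
  also have "\<dots> = (\<Sum>a\<in>A. - r a * ln (r a)) - (\<Sum>b\<in>B. c b * ln (c b)) + s * ln s + s * s / s - s"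
  proof -
    have "(\<Sum>a\<in>A. \<Sum>b\<in>B. - p a b * ln (r a)) = (\<Sum>a\<in>A. - r a * ln (r a))"
      by (simp add: r_def sum_distrib_right sum_negf)
    moreover have "(\<Sum>a\<in>A. \<Sum>b\<in>B. p a b * ln (c b)) = (\<Sum>b\<in>B. c b * ln (c b))"
      by (subst sum.swap) (simp add: c_def sum_distrib_right)
    moreover have "(\<Sum>a\<in>A. \<Sum>b\<in>B. p a b * ln s) = s * ln s"
      by (simp add: s_def r_def sum_distrib_right)
    moreover have "(\<Sum>a\<in>A. \<Sum>b\<in>B. p a b) = s"
      by (simp add: s_def r_def)
    moreover have "(\<Sum>a\<in>A. \<Sum>b\<in>B. r a * c b / s) = s * s / s"
    proof -
      have "(\<Sum>a\<in>A. \<Sum>b\<in>B. r a * c b / s) = (\<Sum>a\<in>A. r a) * (\<Sum>b\<in>B. c b) / s"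
        by (simp add: sum_product sum_divide_distrib)
      then show ?thesis
        by (simp only: s_def[symmetric] s'[symmetric])
    qed
    ultimately show ?thesis
      by (simp add: sum.distrib sum_subtractf)
  qed
  also have "\<dots> = (\<Sum>a\<in>A. eta (r a)) + (\<Sum>b\<in>B. eta (c b)) - eta s"
    by (simp add: eta_def sum_negf)
  finally show ?thesis
    by (simp add: r_def c_def s_def)
qed

text \<open>
  \<open>q E w\<close> is to be read as the probability that a process with values in \<open>P\<close> takes the value
  \<open>w i\<close> at each time \<open>i \<in> E\<close>.
\<close>

locale marginals =
  fixes P :: "'a set" and q :: "'i set \<Rightarrow> ('i \<Rightarrow> 'a) \<Rightarrow> real"
  assumes finite_P: "finite P"
    and q_nonneg: "finite E \<Longrightarrow> w \<in> E \<rightarrow>\<^sub>E P \<Longrightarrow> 0 \<le> q E w"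
    and q_empty: "q {} (\<lambda>_. undefined) = 1"
    and q_insert: "finite E \<Longrightarrow> g \<notin> E \<Longrightarrow> w \<in> E \<rightarrow>\<^sub>E P \<Longrightarrow>
      (\<Sum>a\<in>P. q (insert g E) (w(g := a))) = q E w"

text \<open>Words are extensional, so each is counted once. Words of mass zero contribute
  \<open>eta 0 = 0\<close>, hence empty cells never have to be removed.\<close>

definition ent :: "'a set \<Rightarrow> ('i set \<Rightarrow> ('i \<Rightarrow> 'a) \<Rightarrow> real) \<Rightarrow> 'i set \<Rightarrow> real" where
  "ent P q E = (\<Sum>w\<in>E \<rightarrow>\<^sub>E P. eta (q E w))"

lemma sum_PiE_insert:
  fixes f :: "('i \<Rightarrow> 'a) \<Rightarrow> 'b::comm_monoid_add"
  assumes "g \<notin> E"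
  shows "(\<Sum>w\<in>PiE (insert g E) S. f w) = (\<Sum>w\<in>PiE E S. \<Sum>a\<in>S g. f (w(g := a)))"
proof -
  have "(\<Sum>w\<in>PiE (insert g E) S. f w) = (\<Sum>(a, w)\<in>S g \<times> PiE E S. f (w(g := a)))"
    unfolding PiE_insert_eq
    by (subst sum.reindex) (use inj_combinator[OF assms, of S] in \<open>auto intro!: sum.cong\<close>)
  also have "\<dots> = (\<Sum>w\<in>PiE E S. \<Sum>a\<in>S g. f (w(g := a)))"
    by (subst sum.swap) (simp add: sum.cartesian_product)
  finally show ?thesis .
qed

context marginals
begin

lemma ent_empty: "ent P q {} = 0"
  by (simp add: ent_def q_empty)

lemma update_PiE: "w \<in> E \<rightarrow>\<^sub>E P \<Longrightarrow> a \<in> P \<Longrightarrow> w(g := a) \<in> insert g E \<rightarrow>\<^sub>E P"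
  by (auto simp: PiE_def extensional_def)

lemma ent_mono_insert:
  assumes "finite E"
  shows "ent P q E \<le> ent P q (insert g E)"
proof (cases "g \<in> E")
  case False
  have "ent P q E = (\<Sum>w\<in>E \<rightarrow>\<^sub>E P. eta (\<Sum>a\<in>P. q (insert g E) (w(g := a))))"
    unfolding ent_def using assms False by (intro sum.cong refl) (simp add: q_insert)
  also have "\<dots> \<le> (\<Sum>w\<in>E \<rightarrow>\<^sub>E P. \<Sum>a\<in>P. eta (q (insert g E) (w(g := a))))"
    using assms by (intro sum_mono eta_sum_le finite_P q_nonneg update_PiE) auto
  also have "\<dots> = ent P q (insert g E)"
    using False by (simp add: ent_def sum_PiE_insert)
  finally show ?thesis .
qed (simp add: insert_absorb)

text \<open>For a fixed word \<open>w\<close> over \<open>E\<close> the masses of its extensions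
  form a matrix indexed by the values at \<open>g\<close> and \<open>h\<close>. Its row sums, column
  sums and total are the masses over the smaller index sets, so \<open>eta_sum_submodular\<close>
  applies word by word.\<close>

lemma ent_submodular_insert:
  assumes E: "finite E" and "g \<notin> E" "h \<notin> E" "g \<noteq> h"
  shows "ent P q (insert g (insert h E)) + ent P q E \<le> ent P q (insert g E) + ent P q (insert h E)"
proof -
  let ?p = "\<lambda>w a b. q (insert g (insert h E)) (w(h := b, g := a))"
  have row: "(\<Sum>b\<in>P. ?p w a b) = q (insert g E) (w(g := a))" if "w \<in> E \<rightarrow>\<^sub>E P" "a \<in> P" for w a
  proof -
    have "(\<Sum>b\<in>P. q (insert h (insert g E)) ((w(g := a))(h := b))) = q (insert g E) (w(g := a))"
      using assms that by (intro q_insert update_PiE) auto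
    then show ?thesis
      using assms by (simp add: insert_commute fun_upd_twist)
  qed
  have col: "(\<Sum>a\<in>P. ?p w a b) = q (insert h E) (w(h := b))" if "w \<in> E \<rightarrow>\<^sub>E P" "b \<in> P" for w b
    using assms that by (intro q_insert update_PiE) auto
  have tot: "(\<Sum>a\<in>P. \<Sum>b\<in>P. ?p w a b) = q E w" if "w \<in> E \<rightarrow>\<^sub>E P" for w
    using assms that by (simp add: row q_insert)
  have "(\<Sum>a\<in>P. \<Sum>b\<in>P. eta (?p w a b)) + eta (q E w) \<le>
      (\<Sum>a\<in>P. eta (q (insert g E) (w(g := a)))) + (\<Sum>b\<in>P. eta (q (insert h E) (w(h := b))))"
    if w: "w \<in> E \<rightarrow>\<^sub>E P" for w
  proof -
    have "(\<Sum>a\<in>P. \<Sum>b\<in>P. eta (?p w a b)) + eta (\<Sum>a\<in>P. \<Sum>b\<in>P. ?p w a b) \<le>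
      (\<Sum>a\<in>P. eta (\<Sum>b\<in>P. ?p w a b)) + (\<Sum>b\<in>P. eta (\<Sum>a\<in>P. ?p w a b))"
      using E w by (intro eta_sum_submodular finite_P q_nonneg update_PiE) auto
    then show ?thesis
      using w assms by (simp add: row col q_insert)
  qed
  then have "(\<Sum>w\<in>E \<rightarrow>\<^sub>E P. (\<Sum>a\<in>P. \<Sum>b\<in>P. eta (?p w a b)) + eta (q E w)) \<le>
    (\<Sum>w\<in>E \<rightarrow>\<^sub>E P. (\<Sum>a\<in>P. eta (q (insert g E) (w(g := a)))) + (\<Sum>b\<in>P. eta (q (insert h E) (w(h := b)))))"
    by (rule sum_mono)
  moreover have "ent P q (insert g (insert h E)) = (\<Sum>w\<in>E \<rightarrow>\<^sub>E P. \<Sum>a\<in>P. \<Sum>b\<in>P. eta (?p w a b))"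
    using assms by (simp add: ent_def sum_PiE_insert) (rule sum.cong[OF refl], rule sum.swap)
  ultimately show ?thesis
    using assms by (simp add: ent_def sum_PiE_insert sum.distrib)
qed

text \<open>Conditioning on more coordinates lowers the conditional entropy of the coordinate
  \<open>g\<close>: the elements of \<open>E' - E\<close> are added one at a time, each by
  \<open>ent_submodular_insert\<close>.\<close>

lemma ent_increment_antimono:
  assumes "finite E'" "E \<subseteq> E'" "g \<notin> E'"
  shows "ent P q (insert g E') - ent P q E' \<le> ent P q (insert g E) - ent P q E"
proof -
  have "ent P q (insert g (E \<union> D)) - ent P q (E \<union> D) \<le> ent P q (insert g E) - ent P q E"
    if "finite D" "D \<subseteq> E' - E" for D
    using that
  proof (induction D rule: finite_induct)
    case (insert h D)
    have "ent P q (insert g (insert h (E \<union> D))) + ent P q (E \<union> D)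
      \<le> ent P q (insert g (E \<union> D)) + ent P q (insert h (E \<union> D))"
      using assms insert finite_subset[OF \<open>E \<subseteq> E'\<close>] by (intro ent_submodular_insert) auto
    with insert show ?case by simp
  qed simp
  from this[of "E' - E"] assms show ?thesis
    by (simp add: Un_absorb1)
qed

text \<open>A crude bound, from \<open>eta \<le> 1\<close> for each of the \<open>card P\<close>
  values. Its use is to be uniform in \<open>E\<close>, \<open>g\<close> and the fibre, as dominated
  convergence and \<open>folner_average\<close> require.\<close>

lemma ent_increment_le:
  assumes "finite E" "g \<notin> E"
  shows "ent P q (insert g E) - ent P q E \<le> card P"
proof -
  have "ent P q (insert g E) - ent P q E \<le> ent P q {g} - ent P q {}"
    using assms by (intro ent_increment_antimono) auto
  also have "\<dots> = (\<Sum>a\<in>P. eta (q {g} ((\<lambda>_. undefined)(g := a))))"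
    by (simp add: ent_empty) (simp add: ent_def sum_PiE_insert fun_upd_def)
  also have "\<dots> \<le> (\<Sum>a\<in>P. 1)"
    by (intro sum_mono eta_le_1 q_nonneg) (auto simp: PiE_def extensional_def)
  finally show ?thesis by simp
qed

end

section \<open>Averages along Folner sequences\<close>

text \<open>Telescoping along \<open>R\<close>. The induction deletes the \<open>R\<close>-largest
  element of \<open>D\<close>, because this leaves the predecessors of all other elements
  unchanged.\<close>

lemma sum_increments_along_order:
  fixes F :: "'i set \<Rightarrow> real"
  assumes "finite D" "irreflp R" "transp R" "totalp R"
  shows "F D - F {} = (\<Sum>g\<in>D. F (insert g {h\<in>D. R h g}) - F {h\<in>D. R h g})"
  using \<open>finite D\<close>
proof (induction D rule: finite_psubset_induct)
  case (psubset D)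
  show ?case
  proof (cases "D = {}")
    case False
    have asym: "\<not> (R a b \<and> R b a)" for a b
      using assms by (meson irreflpD transpE)
    have "asymp_on D R"
      using asym by (auto intro: asymp_onI)
    then obtain m where m: "m \<in> D" "\<forall>x\<in>D. x \<noteq> m \<longrightarrow> \<not> R m x"
      using Finite_Set.bex_max_element[OF \<open>finite D\<close> _ _ False, of R] \<open>transp R\<close>
      by (metis subset_UNIV transp_on_subset)
    then have max: "R x m" if "x \<in> D" "x \<noteq> m" for x
      using m that totalpD[OF \<open>totalp R\<close>, of x m] by blast
    define D' where "D' = D - {m}"
    have D: "D = insert m D'" "m \<notin> D'"
      using m by (auto simp: D'_def)
    have below_m: "{h\<in>D. R h m} = D'"
      using max asym m by (auto simp: D'_def)
    have below: "{h\<in>D. R h g} = {h\<in>D'. R h g}" if "g \<in> D'" for g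
      using m that by (auto simp: D'_def)
    have "F D' - F {} = (\<Sum>g\<in>D'. F (insert g {h\<in>D'. R h g}) - F {h\<in>D'. R h g})"
      using psubset.IH[of D'] D by blast
    moreover have "(\<Sum>g\<in>D. F (insert g {h\<in>D. R h g}) - F {h\<in>D. R h g}) =
        F (insert m D') - F D' + (\<Sum>g\<in>D'. F (insert g {h\<in>D'. R h g}) - F {h\<in>D'. R h g})"
    proof -
      have "finite D'"
        using psubset.hyps D by simp
      then have "(\<Sum>g\<in>D. F (insert g {h\<in>D. R h g}) - F {h\<in>D. R h g}) =
        F (insert m {h\<in>D. R h m}) - F {h\<in>D. R h m} +
        (\<Sum>g\<in>D'. F (insert g {h\<in>D. R h g}) - F {h\<in>D. R h g})"
        by (subst (1) D(1)) (simp add: D(2))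
      then show ?thesis
        by (simp only: below_m) (simp add: below)
    qed
    ultimately show ?thesis
      using D(1) by simp
  qed simp
qed

lemma finite_subset_incseq:
  assumes "finite D" "D \<subseteq> (\<Union>n. K n)" "incseq K"
  shows "\<exists>n::nat. D \<subseteq> K n"
  using assms(1,2)
proof (induction D rule: finite_induct)
  case (insert x D)
  then obtain m n where "D \<subseteq> K m" "x \<in> K n"
    by auto
  moreover have "K m \<subseteq> K (max m n)" "K n \<subseteq> K (max m n)"
    using \<open>incseq K\<close> by (auto simp: incseq_def)
  ultimately show ?case
    by blast
qed simp

text \<open>For an empty set the quotient is \<open>0 / 0 = 0\<close>, which cannot persist in a
  sequence with limit 1.\<close>

lemma folner_eventually_nonempty:
  assumes "folner F"
  shows "eventually (\<lambda>n. F n \<noteq> {}) sequentially"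
proof -
  have "(\<lambda>n. real (card (F n \<inter> (\<lambda>h. 0 + h) ` F n)) / real (card (F n))) \<longlonglongrightarrow> 1"
    using assms by (simp only: folner_def)
  then have "eventually (\<lambda>n. real (card (F n \<inter> (\<lambda>h. 0 + h) ` F n)) / real (card (F n)) > 0) sequentially"
    by (rule order_tendstoD) simp
  then show ?thesis
    by eventually_elim auto
qed

text \<open>The averaging argument in a form that serves both groups; \<open>a K\<close> stands for
  the conditional entropy given the window \<open>K\<close>. Since \<open>a\<close> is decreasing,
  every summand is at least \<open>h\<close>. From above, summands whose translate contains a fixed
  window \<open>D\<close> are at most \<open>a D\<close>, which is close to \<open>h\<close>; the
  others are at most \<open>C\<close>, and they are few by Folner invariance.\<close>

lemma folner_average:
  fixes F :: "nat \<Rightarrow> 'g::group_add set" and a H :: "'g set \<Rightarrow> real"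
  assumes F: "folner F"
    and bound: "\<And>K. finite K \<Longrightarrow> a K \<le> C"
    and anti: "\<And>K K'. finite K' \<Longrightarrow> K \<subseteq> K' \<Longrightarrow> a K' \<le> a K"
    and K: "\<And>n. finite (K n)" "incseq K" "(\<Union>n. K n) = UNIV"
    and lim: "(\<lambda>n. a (K n)) \<longlonglongrightarrow> h"
    and H: "\<And>D. finite D \<Longrightarrow> D \<noteq> {} \<Longrightarrow> H D = (\<Sum>g\<in>D. a ((\<lambda>d. d - g) ` D))"
  shows "(\<lambda>n. H (F n) / real (card (F n))) \<longlonglongrightarrow> h"
proof -
  \<comment> \<open>Thus \<open>h\<close> bounds \<open>a\<close> from below on all finite sets, not
    only on the sequence \<open>K\<close>: every finite set lies in some \<open>K n\<close>.\<close>
  have h_le: "h \<le> a D" if D: "finite D" for D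
  proof -
    obtain n where n: "D \<subseteq> K n"
      using finite_subset_incseq[OF D, of K] K by auto
    have "a (K m) \<le> a D" if "n \<le> m" for m
      using n K(1) monoD[OF \<open>incseq K\<close> that] by (intro anti) auto
    with lim show ?thesis
      by (intro LIMSEQ_le_const2) auto
  qed
  have lower: "h \<le> H (F n) / real (card (F n))" if "F n \<noteq> {}" for n
  proof -
    have fin: "finite (F n)"
      using F by (simp add: folner_def)
    have "(\<Sum>g\<in>F n. h) \<le> H (F n)"
      unfolding H[OF fin that] by (intro sum_mono h_le finite_imageI fin)
    then show ?thesis
      using fin that by (simp add: pos_le_divide_eq card_gt_0_iff mult.commute)
  qed
  have upper: "eventually (\<lambda>n. H (F n) / real (card (F n)) < h + e) sequentially" if "0 < e" for e
  proof -
    have "eventually (\<lambda>n. a (K n) < h + e / 2) sequentially"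
      using order_tendstoD(2)[OF lim, of "h + e / 2"] that by simp
    then obtain N where N: "a (K N) < h + e / 2"
      using eventually_happens'[OF sequentially_bot] by blast
    \<comment> \<open>A window that is optimal up to \<open>e / 2\<close>; the other half of
      \<open>e\<close> absorbs the translates that miss part of \<open>D\<close>.\<close>
    define D where "D = K N"
    have D: "finite D" "a D < h + e / 2" "a D \<le> C"
      using K N bound by (auto simp: D_def)
    \<comment> \<open>The translation is by \<open>- k\<close> because \<open>k\<close> has the form
      \<open>d - g\<close> with \<open>d \<in> F n\<close> iff \<open>g\<close> lies in the left
      translate of \<open>F n\<close> by \<open>- k\<close>.\<close>
    define ratio where "ratio k n = real (card (F n \<inter> (\<lambda>h. - k + h) ` F n)) / real (card (F n))" for k n
    have "(\<lambda>n. ratio k n) \<longlonglongrightarrow> 1" for k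
      using F by (simp add: folner_def ratio_def)
    then have "(\<lambda>n. a D + (C - a D) * (\<Sum>k\<in>D. 1 - ratio k n)) \<longlonglongrightarrow> a D + (C - a D) * (\<Sum>k\<in>D. 1 - 1)"
      by (intro tendsto_intros)
    then have "eventually (\<lambda>n. a D + (C - a D) * (\<Sum>k\<in>D. 1 - ratio k n) < h + e) sequentially"
      using D that by (intro order_tendstoD(2)) auto
    then show ?thesis
      using folner_eventually_nonempty[OF F]
    proof eventually_elim
      case (elim n)
      have fin: "finite (F n)"
        using F by (simp add: folner_def)
      then have pos: "0 < real (card (F n))"
        using elim by (simp add: card_gt_0_iff)
      define B where "B k = {g \<in> F n. k + g \<notin> F n}" for k
      have finB: "finite (B k)" for k
        using fin by (simp add: B_def)
      have cardB: "real (card (B k)) = real (card (F n)) * (1 - ratio k n)" for k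
      proof -
        have "F n \<inter> (\<lambda>h. - k + h) ` F n = {g \<in> F n. k + g \<in> F n}"
        proof (intro equalityI subsetI)
          fix g assume "g \<in> {g \<in> F n. k + g \<in> F n}"
          moreover have "g = - k + (k + g)"
            by (simp flip: add.assoc)
          ultimately show "g \<in> F n \<inter> (\<lambda>h. - k + h) ` F n"
            by blast
        qed (auto simp flip: add.assoc)
        then have "F n = B k \<union> (F n \<inter> (\<lambda>h. - k + h) ` F n)" "B k \<inter> (F n \<inter> (\<lambda>h. - k + h) ` F n) = {}"
          by (auto simp: B_def)
        then have "card (F n) = card (B k) + card (F n \<inter> (\<lambda>h. - k + h) ` F n)"
          by (metis card_Un_disjoint fin finB finite_Int)
        then show ?thesis
          using pos by (simp add: ratio_def field_simps)
      qed
      \<comment> \<open>If the translate misses some \<open>k \<in> D\<close>, then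
        \<open>g \<in> B k\<close>, the sum of indicators is at least 1, and the right side is at
        least \<open>C\<close>.\<close>
      have "a ((\<lambda>d. d - g) ` F n) \<le> a D + (C - a D) * (\<Sum>k\<in>D. indicator (B k) g)" if g: "g \<in> F n" for g
      proof (cases "D \<subseteq> (\<lambda>d. d - g) ` F n")
        case True
        then have "a ((\<lambda>d. d - g) ` F n) \<le> a D"
          using fin by (intro anti) auto
        moreover have "0 \<le> (C - a D) * (\<Sum>k\<in>D. indicator (B k) g)"
          using D by (intro mult_nonneg_nonneg sum_nonneg) auto
        ultimately show ?thesis by linarith
      next
        case False
        then obtain k where k: "k \<in> D" "k \<notin> (\<lambda>d. d - g) ` F n"
          by auto
        then have "g \<in> B k"
          using g by (force simp: B_def image_iff)
        then have "indicator (B k) g = (1::real)"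
          by simp
        moreover have "indicator (B k) g \<le> (\<Sum>k\<in>D. indicator (B k) g :: real)"
          using k D by (intro member_le_sum) auto
        ultimately have "C - a D \<le> (C - a D) * (\<Sum>k\<in>D. indicator (B k) g)"
          using D mult_left_mono[of 1 _ "C - a D"] by simp
        moreover have "a ((\<lambda>d. d - g) ` F n) \<le> C"
          using fin by (intro bound) auto
        ultimately show ?thesis by simp
      qed
      then have "H (F n) \<le> (\<Sum>g\<in>F n. a D + (C - a D) * (\<Sum>k\<in>D. indicator (B k) g))"
        using elim fin by (simp add: H sum_mono)
      also have "\<dots> = real (card (F n)) * a D + (C - a D) * (\<Sum>k\<in>D. \<Sum>g\<in>F n. indicator (B k) g)"
        unfolding sum.swap[of "\<lambda>k g. indicator (B k) g" "F n" D]
        by (simp add: sum.distrib sum_distrib_left)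
      also have "(\<Sum>k\<in>D. \<Sum>g\<in>F n. indicator (B k) g) = (\<Sum>k\<in>D. real (card (B k)))"
      proof (intro sum.cong refl)
        fix k
        have "F n \<inter> B k = B k"
          by (auto simp: B_def)
        then show "(\<Sum>g\<in>F n. indicator (B k) g) = real (card (B k))"
          using fin by (simp add: indicator_def of_bool_def sum.If_cases)
      qed
      also have "\<dots> = real (card (F n)) * (\<Sum>k\<in>D. 1 - ratio k n)"
        by (simp only: cardB sum_distrib_left)
      finally have "H (F n) \<le> real (card (F n)) * (a D + (C - a D) * (\<Sum>k\<in>D. 1 - ratio k n))"
        by (simp add: algebra_simps)
      then have "H (F n) / real (card (F n)) \<le> a D + (C - a D) * (\<Sum>k\<in>D. 1 - ratio k n)"
        using pos by (simp add: pos_divide_le_eq mult.commute)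
      with elim show ?case by linarith
    qed
  qed
  show ?thesis
  proof (rule order_tendstoI)
    fix y assume "y < h"
    show "eventually (\<lambda>n. y < H (F n) / real (card (F n))) sequentially"
      using folner_eventually_nonempty[OF F]
    proof eventually_elim
      case (elim n)
      with lower[of n] \<open>y < h\<close> show ?case by linarith
    qed
  next
    fix y assume "h < y"
    then show "eventually (\<lambda>n. H (F n) / real (card (F n)) < y) sequentially"
      using upper[of "y - h"] by simp
  qed
qed

text \<open>This makes \<open>cond_entropy_rate\<close> well determined for the integers: in the
  absence of any Folner sequence every real number would be a common limit.\<close>

lemma folner_int: "folner (\<lambda>n. {0..int n})"
proof -
  have "(\<lambda>n. real (card ({0..int n} \<inter> (\<lambda>h. g + h) ` {0..int n})) / real (card {0..int n})) \<longlonglongrightarrow> 1" for g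
  proof -
    have "(\<lambda>n. (real n + 1 - real_of_int \<bar>g\<bar>) / (real n + 1)) \<longlonglongrightarrow> 1"
      by real_asymp
    moreover have "eventually (\<lambda>n. (real n + 1 - real_of_int \<bar>g\<bar>) / (real n + 1) =
      real (card ({0..int n} \<inter> (\<lambda>h. g + h) ` {0..int n})) / real (card {0..int n})) sequentially"
      using eventually_ge_at_top[of "nat \<bar>g\<bar>"]
    proof eventually_elim
      case (elim n)
      have "{0..int n} \<inter> (\<lambda>h. g + h) ` {0..int n} = {max 0 g..int n + min 0 g}"
      proof -
        have "(\<lambda>h. g + h) ` {0..int n} = {g..int n + g}"
          by simp
        then show ?thesis
          by (simp only:) auto
      qed
      then have "card ({0..int n} \<inter> (\<lambda>h. g + h) ` {0..int n}) = nat (int n + 1 - \<bar>g\<bar>)"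
      proof -
        have "int n + min 0 g - max 0 g + 1 = int n + 1 - \<bar>g\<bar>"
          by simp
        then show ?thesis
          using \<open>_ = {max 0 g..int n + min 0 g}\<close> by simp
      qed
      then show ?case
        using elim by simp
    qed
    ultimately show ?thesis
      by (rule Lim_transform_eventually)
  qed
  then show ?thesis
    by (simp add: folner_def)
qed

section \<open>Orders of type Z\<close>

lemma orders_ZD:
  assumes "R \<in> orders_Z"
  shows "\<not> R a a" "R a b \<Longrightarrow> R b c \<Longrightarrow> R a c" "a \<noteq> b \<Longrightarrow> R a b \<or> R b a"
    "R a b \<Longrightarrow> \<not> R b a"
  using assms unfolding orders_Z_def
  by (auto simp: irreflp_def totalp_on_def dest: transpD)

lemma orders_Z_transp_asymp:
  assumes "R \<in> orders_Z"
  shows "transp_on A R" "asymp_on A R"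
  using orders_ZD(2,4)[OF assms] by (blast intro!: transp_onI asymp_onI)+

lemma orders_Z_finite_between: "R \<in> orders_Z \<Longrightarrow> finite {c. R a c \<and> R c b}"
proof (cases "R a b")
  case False
  assume "R \<in> orders_Z"
  with False have "{c. R a c \<and> R c b} = {}"
    using orders_ZD(2)[of R a _ b] by auto
  then show ?thesis by (simp only: finite.emptyI)
qed (auto simp: orders_Z_def order_interval_def)

section \<open>Successors and the enumeration of an order by the integers\<close>

lemma is_successor_unique:
  assumes "R \<in> orders_Z"
  shows "is_successor R a b \<Longrightarrow> is_successor R a c \<Longrightarrow> b = c"
    and "is_successor R b a \<Longrightarrow> is_successor R c a \<Longrightarrow> b = c"
  using orders_ZD[OF assms] unfolding is_successor_def by metis+

text \<open>The successor is the least element of the finite set of points above \<open>a\<close>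
  and up to \<open>c\<close>, where \<open>c\<close> is any point above \<open>a\<close>.\<close>

lemma ex_is_successor:
  assumes R: "R \<in> orders_Z"
  shows "\<exists>b. is_successor R a b"
proof -
  obtain c where c: "R a c"
    using R unfolding orders_Z_def by blast
  let ?A = "insert c {b. R a b \<and> R b c}"
  have "\<exists>m\<in>?A. \<forall>x\<in>?A. x \<noteq> m \<longrightarrow> \<not> R x m"
    using orders_Z_transp_asymp[OF R]
    by (intro Finite_Set.bex_min_element) (simp_all add: orders_Z_finite_between[OF R])
  then obtain m where m: "m \<in> ?A" "\<And>x. x \<in> ?A \<Longrightarrow> x \<noteq> m \<Longrightarrow> \<not> R x m"
    by auto
  have "\<not> (R a d \<and> R d m)" for d
    using m(2)[of d] m(1) orders_ZD(1)[OF R, of m] orders_ZD(2)[OF R, of d m c] by auto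
  then have "is_successor R a m"
    using m(1) c by (auto simp: is_successor_def)
  then show ?thesis ..
qed

lemma ex_is_predecessor:
  assumes R: "R \<in> orders_Z"
  shows "\<exists>b. is_successor R b a"
proof -
  obtain c where c: "R c a"
    using R unfolding orders_Z_def by blast
  let ?A = "insert c {b. R c b \<and> R b a}"
  have "\<exists>m\<in>?A. \<forall>x\<in>?A. x \<noteq> m \<longrightarrow> \<not> R m x"
    using orders_Z_transp_asymp[OF R]
    by (intro Finite_Set.bex_max_element) (simp_all add: orders_Z_finite_between[OF R])
  then obtain m where m: "m \<in> ?A" "\<And>x. x \<in> ?A \<Longrightarrow> x \<noteq> m \<Longrightarrow> \<not> R m x"
    by auto
  have "\<not> (R m d \<and> R d a)" for d
    using m(2)[of d] m(1) orders_ZD(1)[OF R, of m] orders_ZD(2)[OF R, of c m d] by auto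
  then have "is_successor R m a"
    using m(1) c by (auto simp: is_successor_def)
  then show ?thesis ..
qed

lemma successor_chain_strict:
  assumes R: "R \<in> orders_Z" and f: "\<And>i::int. is_successor R (f i) (f (i + 1))"
  shows "R (f i) (f j) \<longleftrightarrow> i < j"
proof -
  have "R (f i) (f (i + 1 + int n))" for i n
  proof (induction n)
    case 0
    then show ?case using f[of i] by (simp add: is_successor_def)
  next
    case (Suc n)
    have "R (f (i + 1 + int n)) (f (i + 1 + int (Suc n)))"
      using f[of "i + 1 + int n"] by (simp add: is_successor_def add_ac)
    with Suc show ?case using orders_ZD[OF R] by blast
  qed
  then have *: "R (f i) (f j)" if "i < j" for i j
    using that by (metis zle_iff_zadd add1_zle_eq)
  then show ?thesis
    using orders_ZD[OF R] by (metis linorder_neqE)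
qed

text \<open>A point \<open>g\<close> that is missed lies above or below \<open>f 0\<close>. No point
  fits between consecutive values, so \<open>g\<close> lies beyond all values on that side, which
  puts infinitely many of them into one order interval.\<close>

lemma successor_chain_bij:
  assumes R: "R \<in> orders_Z" and f: "\<And>i::int. is_successor R (f i) (f (i + 1))"
  shows "bij f"
proof (rule bijI)
  note less = successor_chain_strict[where f = f, OF R f]
  show inj: "inj f"
    using less orders_ZD(1)[OF R] by (metis injI linorder_neqE)
  \<comment> \<open>The index starts at 1 because the finite set excludes its endpoint
    \<open>f 0\<close>.\<close>
  have unbounded: False if "\<And>n::nat. R (f 0) g \<and> R (f (int n + 1)) g" for g
  proof -
    have "(\<lambda>n. f (int n + 1)) ` UNIV \<subseteq> {c. R (f 0) c \<and> R c g}"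
      using that less by auto
    then have "finite ((\<lambda>n. f (int n + 1)) ` (UNIV :: nat set))"
      using orders_Z_finite_between[OF R] by (rule finite_subset)
    moreover have "inj (\<lambda>n::nat. f (int n + 1))"
      using inj by (auto intro!: injI dest!: injD)
    ultimately show False
      by (simp add: finite_image_iff)
  qed
  have unbounded': False if "\<And>n::nat. R g (f 0) \<and> R g (f (- int n - 1))" for g
  proof -
    have "(\<lambda>n. f (- int n - 1)) ` UNIV \<subseteq> {c. R g c \<and> R c (f 0)}"
      using that less by auto
    then have "finite ((\<lambda>n. f (- int n - 1)) ` (UNIV :: nat set))"
      using orders_Z_finite_between[OF R] by (rule finite_subset)
    moreover have "inj (\<lambda>n::nat. f (- int n - 1))"
      using inj by (auto intro!: injI dest!: injD)
    ultimately show False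
      by (simp add: finite_image_iff)
  qed
  show "surj f"
  proof (rule ccontr)
    assume "\<not> surj f"
    then obtain g where g: "g \<notin> range f"
      by auto
    have up: "R (f (i + 1)) g" if "R (f i) g" for i
      using that f[of i] g orders_ZD(3)[OF R, of g "f (i + 1)"] unfolding is_successor_def by blast
    have down: "R g (f (i - 1))" if "R g (f i)" for i
      using that f[of "i - 1"] g orders_ZD(3)[OF R, of g "f (i - 1)"] unfolding is_successor_def by auto
    have "R (f 0) g \<or> R g (f 0)"
      using g orders_ZD(3)[OF R] by blast
    then show False
    proof
      assume 0: "R (f 0) g"
      have "R (f (int n)) g" for n
      proof (induction n)
        case (Suc n)
        then have "R (f (int n + 1)) g" by (rule up)
        then show ?case by (simp add: add.commute)
      qed (use 0 in simp)
      then show False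
        using unbounded[of g] 0 up by blast
    next
      assume 0: "R g (f 0)"
      have "R g (f (- int n))" for n
      proof (induction n)
        case (Suc n)
        then have "R g (f (- int n - 1))" by (rule down)
        then show ?case by (metis of_nat_Suc diff_conv_add_uminus minus_add_distrib add.commute)
      qed (use 0 in simp)
      then show False
        using unbounded'[of g] 0 down by blast
    qed
  qed
qed

lemma successor_chain_unique:
  assumes R: "R \<in> orders_Z"
    and f: "\<And>i::int. is_successor R (f i) (f (i + 1))"
    and f': "\<And>i::int. is_successor R (f' i) (f' (i + 1))"
    and 0: "f 0 = f' 0"
  shows "f = f'"
proof
  fix i
  show "f i = f' i"
  proof (induction i rule: int_induct[where k = 0])
    case (step1 i)
    then show ?case
      using is_successor_unique(1)[OF R] f[of i] f'[of i] by metis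
  next
    case (step2 i)
    then show ?case
      using is_successor_unique(2)[OF R] f[of "i - 1"] f'[of "i - 1"] by (metis diff_add_cancel)
  qed (fact 0)
qed

lemma ex_successor_chain:
  fixes R :: "'g \<Rightarrow> 'g \<Rightarrow> bool"
  assumes R: "R \<in> orders_Z"
  shows "\<exists>f :: int \<Rightarrow> 'g. f 0 = a \<and> (\<forall>i. is_successor R (f i) (f (i + 1)))"
proof -
  obtain s where s: "\<And>a. is_successor R a (s a)"
    using ex_is_successor[OF R] by metis
  obtain p where p: "\<And>a. is_successor R (p a) a"
    using ex_is_predecessor[OF R] by metis
  define f where "f i = (if 0 \<le> i then (s ^^ nat i) a else (p ^^ nat (- i)) a)" for i
  have "is_successor R (f i) (f (i + 1))" for i
  proof (cases "0 \<le> i")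
    case True
    then have "f (i + 1) = s (f i)"
      by (simp add: f_def nat_add_distrib)
    then show ?thesis using s by simp
  next
    case False
    then have "nat (- i) = Suc (nat (- (i + 1)))"
      by simp
    then have "f i = p (f (i + 1))"
      using False by (auto simp: f_def)
    then show ?thesis using p by simp
  qed
  moreover have "f 0 = a"
    by (simp add: f_def)
  ultimately show ?thesis by blast
qed

context
  fixes R :: "'g::group_add \<Rightarrow> 'g \<Rightarrow> bool"
  assumes R: "R \<in> orders_Z"
begin

text \<open>Justifies the \<open>THE\<close> in \<open>order_enum\<close>: a chain of successors
  through the unit exists, is onto by finiteness of intervals, and is determined by its value at
  0.\<close>

lemma order_enum_props:
  "bij (order_enum R) \<and> order_enum R 0 = 0 \<and>
    (\<forall>i. is_successor R (order_enum R i) (order_enum R (i + 1)))"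
proof -
  obtain f :: "int \<Rightarrow> 'g" where f: "f 0 = 0" "\<And>i. is_successor R (f i) (f (i + 1))"
    using ex_successor_chain[OF R] by metis
  then have "\<exists>!f :: int \<Rightarrow> 'g. bij f \<and> f 0 = 0 \<and> (\<forall>i. is_successor R (f i) (f (i + 1)))"
    using successor_chain_bij[OF R, of f] successor_chain_unique[OF R] by (intro ex1I[of _ f]) auto
  then show ?thesis
    unfolding order_enum_def by (rule theI')
qed

lemma bij_order_enum: "bij (order_enum R)"
  and order_enum_0: "order_enum R 0 = 0"
  and is_successor_order_enum: "is_successor R (order_enum R i) (order_enum R (i + 1))"
  using order_enum_props by auto

lemma order_enum_less_iff: "R (order_enum R i) (order_enum R j) \<longleftrightarrow> i < j"
  by (rule successor_chain_strict[where f = "order_enum R", OF R is_successor_order_enum])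

lemma order_enum_eqI:
  assumes "\<And>i. is_successor R (f i) (f (i + 1))" "f 0 = 0"
  shows "order_enum R = f"
  using successor_chain_unique[where f = "order_enum R" and f' = f, OF R is_successor_order_enum] assms
  by (simp add: order_enum_0)

lemma order_enum_eq_iff: "order_enum R i = order_enum R j \<longleftrightarrow> i = j"
  using bij_order_enum by (auto simp: bij_def inj_def)

lemma order_enum_surj: obtains i where "order_enum R i = g"
  using bij_order_enum by (metis bij_pointE)

lemma act_order_orders_Z: "act_order g R \<in> orders_Z"
proof -
  have "finite (order_interval (act_order g R) a b)" if "act_order g R a b" for a b
  proof -
    have "{c. R (a + g) (c + g) \<and> R (c + g) (b + g)} \<subseteq> (\<lambda>c. c - g) ` {c. R (a + g) c \<and> R c (b + g)}"
      by (auto intro!: image_eqI[of _ _ "_ + g"])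
    then have "finite {c. R (a + g) (c + g) \<and> R (c + g) (b + g)}"
      using orders_Z_finite_between[OF R] by (meson finite_imageI finite_subset)
    then show ?thesis
      by (simp add: order_interval_def act_order_def)
  qed
  moreover have "\<exists>b. act_order g R b a" "\<exists>b. act_order g R a b" for a
  proof -
    obtain b c where "R b (a + g)" "R (a + g) c"
      using R by (auto simp: orders_Z_def) blast
    then have "act_order g R (b - g) a" "act_order g R a (c - g)"
      by (simp_all add: act_order_def)
    then show "\<exists>b. act_order g R b a" "\<exists>b. act_order g R a b"
      by blast+
  qed
  moreover have "irreflp (act_order g R)" "transp (act_order g R)"
    using orders_ZD(1,2)[OF R] unfolding act_order_def irreflp_def transp_def by blast+
  moreover have "totalp (act_order g R)"
    using orders_ZD(3)[OF R] by (auto simp: act_order_def totalp_on_def)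
  ultimately show ?thesis
    by (simp add: orders_Z_def)
qed

end

lemma is_successor_act_order: "is_successor (act_order g R) a b \<longleftrightarrow> is_successor R (a + g) (b + g)"
proof -
  have "(\<exists>c. R (a + g) (c + g) \<and> R (c + g) (b + g)) \<longleftrightarrow> (\<exists>c. R (a + g) c \<and> R c (b + g))"
    by (metis diff_add_cancel)
  then show ?thesis
    by (simp add: is_successor_def act_order_def)
qed

text \<open>The cocycle identity: acting by the \<open>k\<close>-th element moves that element to
  the unit, so positions shift by \<open>k\<close> and elements are translated on the right. It is
  what turns composition of successor steps into addition of indices.\<close>

lemma order_enum_act_order:
  assumes R: "R \<in> orders_Z"
  shows "order_enum (act_order (order_enum R k) R) i = order_enum R (i + k) - order_enum R k"
proof -
  have "order_enum (act_order (order_enum R k) R) = (\<lambda>i. order_enum R (i + k) - order_enum R k)"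
  proof (rule order_enum_eqI[OF act_order_orders_Z[OF R]])
    fix i
    show "is_successor (act_order (order_enum R k) R) (order_enum R (i + k) - order_enum R k)
        (order_enum R (i + 1 + k) - order_enum R k)"
      using is_successor_order_enum[OF R, of "i + k"] by (simp add: is_successor_act_order add_ac)
  qed simp
  then show ?thesis by simp
qed

subsection \<open>Measurability\<close>

lemma space_orders_Z_borel [simp]: "space orders_Z_borel = orders_Z"
  by (simp add: orders_Z_borel_def space_restrict_space)

lemma measurable_orders_Z_rel [measurable]:
  fixes a b :: 'g
  shows "Measurable.pred orders_Z_borel (\<lambda>R. R a b)"
proof -
  have "continuous_on UNIV (\<lambda>R :: 'g \<Rightarrow> 'g \<Rightarrow> bool. R a b)"
    using continuous_on_product_then_coordinatewise[OF continuous_on_product_then_coordinatewise,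
      OF continuous_on_id] .
  then have "open ((\<lambda>R :: 'g \<Rightarrow> 'g \<Rightarrow> bool. R a b) -` {True})"
    by (rule open_vimage[OF discrete_topology_class.open_discrete])
  then have "open {R :: 'g \<Rightarrow> 'g \<Rightarrow> bool. R a b}"
    by (simp add: vimage_def)
  then have "Measurable.pred borel (\<lambda>R :: 'g \<Rightarrow> 'g \<Rightarrow> bool. R a b)"
    by (simp add: pred_def)
  then show ?thesis
    unfolding orders_Z_borel_def by (rule measurable_restrict_space1)
qed

lemma measurable_is_successor [measurable]:
  fixes a b :: "'g::countable"
  shows "Measurable.pred orders_Z_borel (\<lambda>R. is_successor R a b)"
  unfolding is_successor_def by measurable

text \<open>Induction from 0 in both directions: that the new value is \<open>g\<close> means that
  \<open>g\<close> is the neighbour of the previous value \<open>h\<close>, and the union over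
  \<open>h\<close> is countable.\<close>

lemma measurable_order_enum [measurable]:
  "(\<lambda>R. order_enum R i) \<in> measurable orders_Z_borel (count_space (UNIV :: 'g::{group_add,countable} set))"
proof (induction i rule: int_induct[where k = 0])
  case base
  have "(\<lambda>R. 0) \<in> measurable orders_Z_borel (count_space (UNIV :: 'g set))"
    by simp
  then show ?case
    by (rule measurable_cong[THEN iffD1, rotated]) (simp add: order_enum_0)
next
  case (step1 i)
  have "(\<lambda>R. order_enum R (i + 1)) -` {g} \<inter> space orders_Z_borel =
    {R \<in> space orders_Z_borel. \<exists>h. order_enum R i = h \<and> is_successor R h (g :: 'g)}" for g
    using is_successor_order_enum[of _ i] is_successor_unique by fastforce
  moreover have "{R \<in> space orders_Z_borel. \<exists>h. order_enum R i = h \<and> is_successor R h (g :: 'g)} \<in> sets orders_Z_borel" for g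
    using step1(2) by measurable
  ultimately show ?case
    by (auto simp: measurable_count_space_eq2_countable)
next
  case (step2 i)
  have "(\<lambda>R. order_enum R (i - 1)) -` {g} \<inter> space orders_Z_borel =
    {R \<in> space orders_Z_borel. \<exists>h. order_enum R i = h \<and> is_successor R (g :: 'g) h}" for g
    using is_successor_order_enum[of _ "i - 1"] is_successor_unique by fastforce
  moreover have "{R \<in> space orders_Z_borel. \<exists>h. order_enum R i = h \<and> is_successor R (g :: 'g) h} \<in> sets orders_Z_borel" for g
    using step2(2) by measurable
  ultimately show ?case
    by (auto simp: measurable_count_space_eq2_countable)
qed

section \<open>Conditional entropy as an integral\<close>

text \<open>A nonempty cell determines its word, because \<open>g i a\<close> and
  \<open>g i b\<close> are disjoint for different letters. Partitions \<open>Q i\<close> that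
  coincide for several \<open>i\<close> collapse to one member of the family, but words that pick
  different blocks of them have an empty cell, which \<open>f {} = 0\<close> makes harmless.\<close>

lemma sum_common_refinement:
  fixes g :: "'i \<Rightarrow> 'a \<Rightarrow> 'x set" and f :: "'x set \<Rightarrow> real"
  assumes E: "finite E" "E \<noteq> {}"
    and S: "\<And>i. i \<in> E \<Longrightarrow> finite (S i)"
    and Q: "\<And>i. i \<in> E \<Longrightarrow> Q i = g i ` S i - {{}}"
    and disj: "\<And>i a b. i \<in> E \<Longrightarrow> a \<in> S i \<Longrightarrow> b \<in> S i \<Longrightarrow> a \<noteq> b \<Longrightarrow> g i a \<inter> g i b = {}"
    and f: "f {} = 0"
  shows "(\<Sum>C\<in>common_refinement (Q ` E). f C) = (\<Sum>w\<in>PiE E S. f (\<Inter>i\<in>E. g i (w i)))"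
    and "common_refinement (Q ` E) = (\<lambda>w. \<Inter>i\<in>E. g i (w i)) ` PiE E S - {{}}"
proof -
  define c where "c w = (\<Inter>i\<in>E. g i (w i))" for w
  define W where "W = {w \<in> PiE E S. c w \<noteq> {}}"
  have inj: "inj_on c W"
  proof (rule inj_onI)
    fix w w' assume w: "w \<in> W" "w' \<in> W" "c w = c w'"
    then obtain x where "x \<in> c w" "x \<in> c w'"
      by (auto simp: W_def)
    then have "w i = w' i" if "i \<in> E" for i
    proof -
      have "x \<in> g i (w i) \<inter> g i (w' i)" "w i \<in> S i" "w' i \<in> S i"
        using that w \<open>x \<in> c w\<close> \<open>x \<in> c w'\<close> unfolding c_def W_def by auto
      then show ?thesis
        using disj[OF that] by blast
    qed
    with w show "w = w'"
      by (intro PiE_ext[of w E S w']) (auto simp: W_def)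
  qed
  have img: "common_refinement (Q ` E) = c ` W"
  proof (intro equalityI subsetI)
    fix C assume "C \<in> common_refinement (Q ` E)"
    then obtain h where h: "h \<in> Pi (Q ` E) (\<lambda>P. P)" "C = \<Inter> (h ` (Q ` E))" "C \<noteq> {}"
      by (auto simp: common_refinement)
    have "\<exists>a\<in>S i. h (Q i) = g i a" if i: "i \<in> E" for i
    proof -
      have "h (Q i) \<in> Q i" using h(1) i by auto
      with Q[OF i] show ?thesis by auto
    qed
    then obtain w where w: "\<And>i. i \<in> E \<Longrightarrow> w i \<in> S i \<and> h (Q i) = g i (w i)"
      by metis
    have "C = c (restrict w E)"
      using h(2) w by (auto simp: c_def)
    moreover have "restrict w E \<in> PiE E S"
      using w by auto
    ultimately show "C \<in> c ` W"
      using h(3) by (auto simp: W_def)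
  next
    fix C assume "C \<in> c ` W"
    then obtain w x where w: "w \<in> PiE E S" "C = c w" "x \<in> c w"
      by (auto simp: W_def)
    \<comment> \<open>A choice function on the family of partitions may depend on \<open>Q i\<close>
      but not on \<open>i\<close>; taking the block that contains \<open>x\<close> achieves
      this.\<close>
    define h where "h P = (SOME A. A \<in> P \<and> x \<in> A)" for P :: "'x set set"
    have h: "h (Q i) = g i (w i)" "g i (w i) \<in> Q i" if i: "i \<in> E" for i
    proof -
      have x: "x \<in> g i (w i)" "w i \<in> S i"
        using w i by (auto simp: c_def)
      then show "g i (w i) \<in> Q i"
        using Q[OF i] by auto
      then have "h (Q i) \<in> Q i \<and> x \<in> h (Q i)"
        unfolding h_def using x by (intro someI[of "\<lambda>A. A \<in> Q i \<and> x \<in> A" "g i (w i)"]) auto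
      then obtain a where "a \<in> S i" "h (Q i) = g i a" "x \<in> g i a"
        using Q[OF i] by auto
      then show "h (Q i) = g i (w i)"
        using x disj[OF i, of a "w i"] by blast
    qed
    then have "C = \<Inter> (h ` (Q ` E))" "h \<in> Pi (Q ` E) (\<lambda>P. P)"
      using w by (auto simp: c_def)
    then show "C \<in> common_refinement (Q ` E)"
      using w by (auto simp: common_refinement)
  qed
  show "common_refinement (Q ` E) = (\<lambda>w. \<Inter>i\<in>E. g i (w i)) ` PiE E S - {{}}"
    unfolding img by (auto simp: W_def c_def)
  have "(\<Sum>C\<in>common_refinement (Q ` E). f C) = (\<Sum>w\<in>W. f (c w))"
    unfolding img by (simp add: sum.reindex[OF inj])
  also have "\<dots> = (\<Sum>w\<in>PiE E S. f (c w))"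
    using E S f by (intro sum.mono_neutral_left finite_PiE) (auto simp: W_def)
  finally show "(\<Sum>C\<in>common_refinement (Q ` E). f C) = (\<Sum>w\<in>PiE E S. f (\<Inter>i\<in>E. g i (w i)))"
    by (simp add: c_def)
qed

lemma sum_common_refinement_pair:
  fixes f :: "'x set \<Rightarrow> real"
  assumes "partition_on \<Omega> P" "partition_on \<Omega> Q" "finite P" "finite Q" "f {} = 0"
  shows "(\<Sum>C\<in>common_refinement {P, Q}. f C) = (\<Sum>B\<in>Q. \<Sum>A\<in>P. f (A \<inter> B))"
proof -
  \<comment> \<open>Indexing by booleans reduces the pair to \<open>sum_common_refinement\<close>
    and also covers \<open>P = Q\<close>, where \<open>{P, Q}\<close> is a singleton.\<close>
  define S where "S b = (if b then P else Q)" for b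
  have part: "partition_on \<Omega> (S b)" for b
    using assms by (simp add: S_def)
  have "(\<Sum>C\<in>common_refinement (S ` {True, False}). f C) =
    (\<Sum>w\<in>PiE {True, False} S. f (\<Inter>i\<in>{True, False}. w i))"
  proof (rule sum_common_refinement(1)[where g = "\<lambda>_ a. a"])
    show "S i = (\<lambda>a. a) ` S i - {{}}" for i
      using part[of i] by (auto simp: partition_on_def)
    show "a \<inter> b = {}" if "a \<in> S i" "b \<in> S i" "a \<noteq> b" for i a b
      using part[of i] that by (auto simp: partition_on_def disjoint_def)
  qed (use assms in \<open>auto simp: S_def\<close>)
  also have "\<dots> = (\<Sum>B\<in>Q. \<Sum>A\<in>P. f (A \<inter> B))"
    by (simp add: sum_PiE_insert S_def)
  finally show ?thesis
    by (simp add: S_def insert_commute)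
qed

section \<open>Conditional probabilities over a factor\<close>

lemma integrable_indicator_mult:
  fixes f :: "'a \<Rightarrow> real"
  shows "b \<in> sets N \<Longrightarrow> integrable N f \<Longrightarrow> integrable N (\<lambda>r. indicator b r * f r)"
  using integrable_real_mult_indicator[of b N f] by (simp add: mult.commute)

lemma partition_on_fibers: "partition_on \<Omega> ((\<lambda>v. F -` {v} \<inter> \<Omega>) ` F ` \<Omega>)"
  by (auto simp: partition_on_def disjoint_def)

locale prob_factor = M: prob_space M + N: prob_space N
  for M :: "'x measure" and N :: "'r measure" +
  fixes \<phi> :: "'x \<Rightarrow> 'r"
  assumes preserving: "measure_preserving M N \<phi>"
begin

lemma measurable_phi [measurable]: "\<phi> \<in> measurable M N"
  and distr_phi: "distr M N \<phi> = N"
  using preserving by (auto simp: measure_preserving_def)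

text \<open>Conditional probabilities are functions on the factor space, so that a fibre is
  addressed by its point \<open>r\<close>. The bounds hold at every \<open>r\<close>, which lets
  \<open>eta\<close> be estimated without an exceptional set.\<close>

definition is_cond_prob :: "'x set \<Rightarrow> ('r \<Rightarrow> real) \<Rightarrow> bool" where
  "is_cond_prob A f \<longleftrightarrow> f \<in> borel_measurable N \<and> (\<forall>r. 0 \<le> f r \<and> f r \<le> 1) \<and>
     (\<forall>b\<in>sets N. (\<integral>r. indicator b r * f r \<partial>N) = measure M (A \<inter> \<phi> -` b))"

definition cond_prob :: "'x set \<Rightarrow> 'r \<Rightarrow> real" where
  "cond_prob A = (SOME f. is_cond_prob A f)"

text \<open>The image under \<open>\<phi>\<close> of \<open>M\<close> restricted to \<open>A\<close>
  is dominated by \<open>N\<close>, so it has a Radon-Nikodym density that is at most 1 almost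
  everywhere. Truncation at 1 makes the bound hold everywhere.\<close>

lemma ex_cond_prob:
  assumes A: "A \<in> sets M"
  shows "\<exists>f. is_cond_prob A f"
proof -
  have A': "A \<inter> space M \<in> sets M" "A \<inter> space M = A"
    using A sets.sets_into_space by auto
  define L where "L = distr (restrict_space M A) N \<phi>"
  have space_A: "space (restrict_space M A) = A"
    using A' by (simp add: space_restrict_space2)
  have meas_A: "\<phi> \<in> measurable (restrict_space M A) N"
    by (simp add: measurable_restrict_space1)
  have phi_vimage: "\<phi> -` b \<inter> A \<in> sets M" if "b \<in> sets N" for b
  proof -
    have "\<phi> -` b \<inter> A = (\<phi> -` b \<inter> space M) \<inter> A"
      using sets.sets_into_space[OF A] by auto
    then show ?thesis using that A by simp
  qed
  have L: "emeasure L b = emeasure M (A \<inter> \<phi> -` b)" if b: "b \<in> sets N" for b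
    using A' b unfolding L_def
    by (simp add: emeasure_distr[OF meas_A] space_A emeasure_restrict_space Int_commute)
  have L_le: "emeasure L b \<le> emeasure N b" if b: "b \<in> sets N" for b
  proof -
    have "emeasure L b \<le> emeasure M (\<phi> -` b \<inter> space M)"
      unfolding L[OF b] using sets.sets_into_space[OF A] b by (intro emeasure_mono) auto
    also have "\<dots> = emeasure N b"
      using emeasure_distr[OF measurable_phi b] by (simp add: distr_phi)
    finally show ?thesis .
  qed
  have sets_L: "sets L = sets N"
    by (simp add: L_def)
  have "absolutely_continuous N L"
    unfolding absolutely_continuous_def
  proof
    fix b assume "b \<in> null_sets N"
    then show "b \<in> null_sets L"
      using L_le[of b] sets_L by (auto simp: null_sets_def)
  qed
  then obtain f where f[measurable]: "f \<in> borel_measurable N" and fL: "density N f = L"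
    using N.Radon_Nikodym sets_L by blast
  have int_f: "(\<integral>\<^sup>+r. f r * indicator b r \<partial>N) = emeasure L b" if "b \<in> sets N" for b
    using that by (simp add: emeasure_density flip: fL)
  \<comment> \<open>Over \<open>b\<close> the integral of \<open>f\<close> is the
    \<open>L\<close>-measure of \<open>b\<close>, hence at most its \<open>N\<close>-measure. So
    \<open>f - 1\<close>, positive on \<open>b\<close>, has integral 0 there, and \<open>b\<close>
    is a null set.\<close>
  define b where "b = {r \<in> space N. 1 < f r}"
  have b[measurable]: "b \<in> sets N"
    by (simp add: b_def)
  have "(\<integral>\<^sup>+r. (f r * indicator b r - indicator b r) \<partial>N) =
      (\<integral>\<^sup>+r. f r * indicator b r \<partial>N) - (\<integral>\<^sup>+r. indicator b r \<partial>N)"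
  proof (rule nn_integral_diff)
    show "AE r in N. indicator b r \<le> f r * indicator b r"
      by (auto simp: b_def indicator_def intro!: AE_I2)
  qed (simp_all add: N.emeasure_eq_measure)
  also have "\<dots> = 0"
    using L_le[OF b] le_less_trans[OF L_le[OF b], of top]
    by (simp add: int_f diff_eq_0_ennreal N.emeasure_eq_measure)
  finally have "AE r in N. f r * indicator b r - indicator b r = 0"
    by (subst (asm) nn_integral_0_iff_AE) auto
  then have f_le: "AE r in N. f r \<le> 1"
    using AE_space
  proof eventually_elim
    case (elim r)
    show ?case
    proof (rule ccontr)
      assume "\<not> f r \<le> 1"
      with elim have "f r - 1 = 0" "1 < f r"
        by (auto simp: b_def)
      then show False
        by (auto simp: diff_eq_0_iff_ennreal)
    qed
  qed
  define g where "g r = enn2real (min 1 (f r))" for r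
  have g: "ennreal (g r) = min 1 (f r)" for r
    by (simp add: g_def ennreal_enn2real_if min_def top_unique)
  have [measurable]: "g \<in> borel_measurable N"
    unfolding g_def by measurable
  have g01: "0 \<le> g r" "g r \<le> 1" for r
    using g[of r] by (auto simp: g_def min_def intro!: enn2real_leI)
  have "(\<integral>r. indicator b r * g r \<partial>N) = measure M (A \<inter> \<phi> -` b)" if b: "b \<in> sets N" for b
  proof -
    have "(\<integral>r. indicator b r * g r \<partial>N) = enn2real (\<integral>\<^sup>+r. ennreal (indicator b r * g r) \<partial>N)"
      using b g01 by (intro integral_eq_nn_integral) auto
    also have "(\<integral>\<^sup>+r. ennreal (indicator b r * g r) \<partial>N) = (\<integral>\<^sup>+r. f r * indicator b r \<partial>N)"
      using f_le
    proof (intro nn_integral_cong_AE, eventually_elim)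
      case (elim r)
      then show ?case
        using g[of r] by (auto simp: indicator_def min_def)
    qed
    also have "\<dots> = emeasure M (A \<inter> \<phi> -` b)"
      using b by (simp add: int_f L)
    finally show ?thesis
      by (simp add: measure_def)
  qed
  then have "is_cond_prob A g"
    using g01 by (simp add: is_cond_prob_def)
  then show ?thesis by blast
qed

context
  fixes A assumes A: "A \<in> sets M"
begin

lemma is_cond_prob: "is_cond_prob A (cond_prob A)"
  unfolding cond_prob_def using ex_cond_prob[OF A] by (rule someI_ex)

lemma measurable_cond_prob [measurable (raw)]: "cond_prob A \<in> borel_measurable N"
  and cond_prob_nonneg: "0 \<le> cond_prob A r"
  and cond_prob_le_1: "cond_prob A r \<le> 1"
  and integral_cond_prob: "b \<in> sets N \<Longrightarrow> (\<integral>r. indicator b r * cond_prob A r \<partial>N) = measure M (A \<inter> \<phi> -` b)"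
  using is_cond_prob by (auto simp: is_cond_prob_def)

lemma integrable_cond_prob: "integrable N (cond_prob A)"
  using cond_prob_nonneg cond_prob_le_1
  by (intro N.integrable_const_bound[of _ 1] measurable_cond_prob) auto

end

lemma AE_eq_of_integrals:
  fixes f g :: "'r \<Rightarrow> real"
  assumes "integrable N f" "integrable N g"
    and "\<And>b. b \<in> sets N \<Longrightarrow> (\<integral>r. indicator b r * f r \<partial>N) = (\<integral>r. indicator b r * g r \<partial>N)"
  shows "AE r in N. f r = g r"
  using assms by (intro density_unique_real) (auto simp: set_lebesgue_integral_def)

lemma phi_vimage_sets: "A \<in> sets M \<Longrightarrow> b \<in> sets N \<Longrightarrow> A \<inter> \<phi> -` b \<in> sets M"
proof -
  assume A: "A \<in> sets M" and b: "b \<in> sets N"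
  have "A \<inter> \<phi> -` b = A \<inter> (\<phi> -` b \<inter> space M)"
    using sets.sets_into_space[OF A] by auto
  then show ?thesis using A b by simp
qed

lemma cond_prob_sum:
  assumes "finite I" and A: "\<And>i. i \<in> I \<Longrightarrow> A i \<in> sets M" and disj: "disjoint_family_on A I"
  shows "AE r in N. cond_prob (\<Union>i\<in>I. A i) r = (\<Sum>i\<in>I. cond_prob (A i) r)"
proof (rule AE_eq_of_integrals)
  have U: "(\<Union>i\<in>I. A i) \<in> sets M"
    using assms by auto
  then show "integrable N (cond_prob (\<Union>i\<in>I. A i))"
    by (rule integrable_cond_prob)
  show "integrable N (\<lambda>r. \<Sum>i\<in>I. cond_prob (A i) r)"
    using A by (intro Bochner_Integration.integrable_sum integrable_cond_prob)
  fix b assume b: "b \<in> sets N"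
  have "(\<integral>r. indicator b r * (\<Sum>i\<in>I. cond_prob (A i) r) \<partial>N) =
      (\<Sum>i\<in>I. \<integral>r. indicator b r * cond_prob (A i) r \<partial>N)"
    unfolding sum_distrib_left using A b
    by (intro Bochner_Integration.integral_sum integrable_indicator_mult) (auto intro: integrable_cond_prob)
  also have "\<dots> = (\<Sum>i\<in>I. measure M (A i \<inter> \<phi> -` b))"
    using A b by (simp add: integral_cond_prob)
  also have "\<dots> = measure M (\<Union>i\<in>I. A i \<inter> \<phi> -` b)"
    using A b assms by (intro M.finite_measure_finite_Union[symmetric])
      (auto simp: disjoint_family_on_def intro: phi_vimage_sets)
  finally show "(\<integral>r. indicator b r * cond_prob (\<Union>i\<in>I. A i) r \<partial>N) =
      (\<integral>r. indicator b r * (\<Sum>i\<in>I. cond_prob (A i) r) \<partial>N)"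
    using U b by (simp add: integral_cond_prob Int_UN_distrib2)
qed

lemma measure_phi_vimage: "b \<in> sets N \<Longrightarrow> measure M (\<phi> -` b \<inter> space M) = measure N b"
  using measure_distr[OF measurable_phi, of b] by (simp add: distr_phi)

lemma cond_prob_space: "AE r in N. cond_prob (space M) r = 1"
  using measure_phi_vimage
  by (intro AE_eq_of_integrals integrable_cond_prob) (auto simp: integral_cond_prob Int_commute)

text \<open>Conditional probability is local on the factor. This lets a transformation that depends
  on \<open>x\<close> only through \<open>\<phi> x\<close> be replaced by a fixed one over each set
  \<open>c\<close> on which it is constant.\<close>

lemma cond_prob_cong:
  assumes A: "A \<in> sets M" and B: "B \<in> sets M" and c: "c \<in> sets N"
    and eq: "AE x in M. \<phi> x \<in> c \<longrightarrow> (x \<in> A \<longleftrightarrow> x \<in> B)"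
  shows "AE r in N. r \<in> c \<longrightarrow> cond_prob A r = cond_prob B r"
proof -
  have "AE r in N. indicator c r * cond_prob A r = indicator c r * cond_prob B r"
  proof (rule AE_eq_of_integrals)
    show "integrable N (\<lambda>r. indicator c r * cond_prob A r)" "integrable N (\<lambda>r. indicator c r * cond_prob B r)"
      using A B c by (auto intro!: integrable_indicator_mult integrable_cond_prob)
    fix b assume b: "b \<in> sets N"
    have "measure M (A \<inter> \<phi> -` (b \<inter> c)) = measure M (B \<inter> \<phi> -` (b \<inter> c))"
      using eq b c A B by (intro M.finite_measure_eq_AE phi_vimage_sets) auto
    then have "(\<integral>r. indicator (b \<inter> c) r * cond_prob A r \<partial>N) = (\<integral>r. indicator (b \<inter> c) r * cond_prob B r \<partial>N)"
      using A B b c by (simp add: integral_cond_prob)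
    then show "(\<integral>r. indicator b r * (indicator c r * cond_prob A r) \<partial>N) =
        (\<integral>r. indicator b r * (indicator c r * cond_prob B r) \<partial>N)"
      by (simp add: indicator_inter_arith mult.assoc)
  qed
  then show ?thesis
    by eventually_elim auto
qed

text \<open>Tested against sets \<open>b\<close>: the inverse \<open>v\<close> turns
  \<open>b\<close> into a set whose preimage under \<open>u\<close> is \<open>b\<close>, after which
  the invariance of \<open>N\<close> under \<open>u\<close> and of \<open>M\<close> under
  \<open>t\<close> transports the integrals.\<close>

lemma cond_prob_equivariant:
  assumes A: "A \<in> sets M"
    and t: "measure_preserving M M t" and u: "measure_preserving N N u"
    and v [measurable]: "v \<in> measurable N N" and vu: "\<And>r. r \<in> space N \<Longrightarrow> v (u r) = r"
    and eq: "AE x in M. \<phi> (t x) = u (\<phi> x)"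
  shows "AE r in N. cond_prob (t -` A \<inter> space M) r = cond_prob A (u r)"
proof (rule AE_eq_of_integrals)
  have [measurable]: "t \<in> measurable M M" "u \<in> measurable N N"
    and dt: "distr M M t = M" and du: "distr N N u = N"
    using t u by (auto simp: measure_preserving_def)
  have tA: "t -` A \<inter> space M \<in> sets M"
    using A by simp
  then show "integrable N (cond_prob (t -` A \<inter> space M))"
    by (rule integrable_cond_prob)
  show "integrable N (\<lambda>r. cond_prob A (u r))"
    using cond_prob_nonneg[OF A] cond_prob_le_1[OF A] measurable_cond_prob[OF A]
    by (intro N.integrable_const_bound[of _ 1]) auto
  fix b assume b[measurable]: "b \<in> sets N"
  let ?b = "v -` b \<inter> space N"
  have b': "?b \<in> sets N"
    by simp
  have "(\<integral>r. indicator b r * cond_prob A (u r) \<partial>N) = (\<integral>r. indicator ?b (u r) * cond_prob A (u r) \<partial>N)"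
    using measurable_space[OF \<open>u \<in> measurable N N\<close>] vu
    by (intro Bochner_Integration.integral_cong) (auto simp: indicator_def)
  also have "\<dots> = (\<integral>r. indicator ?b r * cond_prob A r \<partial>N)"
    using measurable_cond_prob[OF A] by (subst (2) du[symmetric], subst integral_distr) auto
  also have "\<dots> = measure M (A \<inter> \<phi> -` ?b)"
    using A b' by (rule integral_cond_prob)
  also have "\<dots> = measure M (t -` (A \<inter> \<phi> -` ?b) \<inter> space M)"
    using phi_vimage_sets[OF A b'] by (subst dt[symmetric], subst measure_distr) auto
  also have "\<dots> = measure M ((t -` A \<inter> space M) \<inter> \<phi> -` b)"
  proof (rule M.finite_measure_eq_AE)
    show "t -` (A \<inter> \<phi> -` ?b) \<inter> space M \<in> sets M" "(t -` A \<inter> space M) \<inter> \<phi> -` b \<in> sets M"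
      using measurable_sets[OF \<open>t \<in> measurable M M\<close> phi_vimage_sets[OF A b']] phi_vimage_sets[OF tA b] .
    show "AE x in M. x \<in> t -` (A \<inter> \<phi> -` ?b) \<inter> space M \<longleftrightarrow> x \<in> (t -` A \<inter> space M) \<inter> \<phi> -` b"
      using eq AE_space
    proof eventually_elim
      case (elim x)
      then show ?case
        using vu measurable_space[OF measurable_phi] measurable_space[OF \<open>u \<in> measurable N N\<close>] by auto
    qed
  qed
  finally show "(\<integral>r. indicator b r * cond_prob (t -` A \<inter> space M) r \<partial>N) = (\<integral>r. indicator b r * cond_prob A (u r) \<partial>N)"
    using tA b by (simp add: integral_cond_prob)
qed

section \<open>The infimum over finite partitions as an integral over the factor\<close>

context
  fixes \<Theta> :: "'x measure" and R :: "'x set set"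
  assumes sets_\<Theta>: "sets \<Theta> = {\<phi> -` b \<inter> space M |b. b \<in> sets N}"
    and R: "finite_partition M M R"
begin

lemma partition_facts: "finite R" "partition_on (space M) R" "A \<in> R \<Longrightarrow> A \<in> sets M"
  using R by (auto simp: finite_partition_def)

lemma subalgebra_sets: "B \<in> sets \<Theta> \<Longrightarrow> B \<in> sets M"
  by (auto simp: sets_\<Theta>)

lemma measurable_cond_prob_phi [measurable]: "A \<in> R \<Longrightarrow> (\<lambda>x. cond_prob A (\<phi> x)) \<in> borel_measurable M"
  by (rule measurable_compose[OF measurable_phi measurable_cond_prob[OF partition_facts(3)]])

lemma integral_cond_prob_phi:
  assumes A: "A \<in> R" and B: "B \<in> sets \<Theta>"
  shows "(\<integral>x. indicator B x * cond_prob A (\<phi> x) \<partial>M) = measure M (A \<inter> B)"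
proof -
  obtain b where b: "b \<in> sets N" "B = \<phi> -` b \<inter> space M"
    using B by (auto simp: sets_\<Theta>)
  have [measurable]: "cond_prob A \<in> borel_measurable N" "b \<in> sets N"
    using measurable_cond_prob[OF partition_facts(3)[OF A]] b by auto
  have "(\<integral>x. indicator B x * cond_prob A (\<phi> x) \<partial>M) = (\<integral>x. indicator b (\<phi> x) * cond_prob A (\<phi> x) \<partial>M)"
    by (intro Bochner_Integration.integral_cong) (auto simp: b indicator_def)
  also have "\<dots> = (\<integral>r. indicator b r * cond_prob A r \<partial>N)"
    by (subst distr_phi[symmetric], subst integral_distr) auto
  also have "\<dots> = measure M (A \<inter> \<phi> -` b)"
    using partition_facts(3)[OF A] b(1) by (rule integral_cond_prob)
  also have "A \<inter> \<phi> -` b = A \<inter> B"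
    using sets.sets_into_space[OF partition_facts(3)[OF A]] by (auto simp: b)
  finally show ?thesis .
qed

lemma sum_partition_measure:
  assumes B: "B \<in> sets M"
  shows "(\<Sum>A\<in>R. measure M (A \<inter> B)) = measure M B"
proof -
  have "disjoint_family_on (\<lambda>A. A \<inter> B) R"
    using partition_facts(2) unfolding disjoint_family_on_def partition_on_def disjoint_def by blast
  then have "measure M (\<Union>A\<in>R. A \<inter> B) = (\<Sum>A\<in>R. measure M (A \<inter> B))"
    using partition_facts B by (intro M.finite_measure_finite_Union) auto
  moreover have "(\<Union>A\<in>R. A \<inter> B) = B"
    using partition_facts(2) sets.sets_into_space[OF B] by (auto simp: partition_on_def)
  ultimately show ?thesis by simp
qed

lemma cond_prob_bounds: "A \<in> R \<Longrightarrow> 0 \<le> cond_prob A r" "A \<in> R \<Longrightarrow> cond_prob A r \<le> 1"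
  using cond_prob_nonneg cond_prob_le_1 partition_facts(3) by auto

lemma integrable_cond_prob_phi: "A \<in> R \<Longrightarrow> integrable M (\<lambda>x. cond_prob A (\<phi> x))"
  using cond_prob_bounds by (intro M.integrable_const_bound[of _ 1] measurable_cond_prob_phi) auto

lemma integrable_eta_cond_prob_phi: "A \<in> R \<Longrightarrow> integrable M (\<lambda>x. eta (cond_prob A (\<phi> x)))"
  using cond_prob_bounds eta_le_1 eta_nonneg
  by (intro M.integrable_const_bound[of _ 1] measurable_compose[OF measurable_cond_prob_phi borel_measurable_eta]) auto

text \<open>Jensen's inequality on \<open>B\<close>. The right side is
  \<open>\<beta> * eta (m / \<beta>)\<close> with \<open>m\<close> the measure of
  \<open>A \<inter> B\<close> and \<open>\<beta>\<close> that of \<open>B\<close>, written in a form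
  that stays meaningful for \<open>\<beta> = 0\<close>.\<close>

lemma integral_eta_cond_prob_le:
  assumes A: "A \<in> R" and B: "B \<in> sets \<Theta>"
  shows "(\<integral>x. indicator B x * eta (cond_prob A (\<phi> x)) \<partial>M)
    \<le> eta (measure M (A \<inter> B)) + measure M (A \<inter> B) * ln (measure M B)"
proof -
  define m where "m = measure M (A \<inter> B)"
  define \<beta> where "\<beta> = measure M B"
  have BM [measurable]: "B \<in> sets M"
    using B by (rule subalgebra_sets)
  have int_B: "integrable M (indicator B :: 'x \<Rightarrow> real)"
    using BM by (intro integrable_real_indicator) (auto simp: M.emeasure_eq_measure)
  have int: "integrable M (\<lambda>x. indicator B x * cond_prob A (\<phi> x))"
    "integrable M (\<lambda>x. indicator B x * eta (cond_prob A (\<phi> x)))"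
    using A BM by (auto intro!: integrable_indicator_mult integrable_cond_prob_phi integrable_eta_cond_prob_phi)
  have "m \<le> \<beta>"
    unfolding m_def \<beta>_def by (intro M.finite_measure_mono) (auto simp: BM)
  show ?thesis
  proof (cases "m = 0")
    case True
    then have "(\<integral>x. indicator B x * cond_prob A (\<phi> x) \<partial>M) = 0"
      using integral_cond_prob_phi[OF A B] by (simp add: m_def)
    then have "AE x in M. indicator B x * cond_prob A (\<phi> x) = 0"
      using int(1) cond_prob_bounds[OF A] by (subst (asm) integral_nonneg_eq_0_iff_AE) auto
    then have "(\<integral>x. indicator B x * eta (cond_prob A (\<phi> x)) \<partial>M) = (\<integral>x. 0 \<partial>M)"
      using int(2) by (intro integral_cong_AE) auto
    then show ?thesis
      using True by (simp add: m_def)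
  next
    case False
    then have "0 < m"
      by (simp add: m_def zero_less_measure_iff)
    then have pos: "0 < m" "0 < \<beta>"
      using \<open>m \<le> \<beta>\<close> by simp_all
    \<comment> \<open>The tangent is taken at the mean of the conditional probability over
      \<open>B\<close>. It does not exist at mean 0, hence the separate case \<open>m = 0\<close>,
      where the conditional probability vanishes almost everywhere on \<open>B\<close>.\<close>
    define t where "t = m / \<beta>"
    have t: "0 < t"
      using pos by (simp add: t_def)
    have "(\<integral>x. indicator B x * eta (cond_prob A (\<phi> x)) \<partial>M) \<le>
        (\<integral>x. (- ln t - 1) * (indicator B x * cond_prob A (\<phi> x)) + t * indicator B x \<partial>M)"
    proof (rule integral_mono)
      show "integrable M (\<lambda>x. (- ln t - 1) * (indicator B x * cond_prob A (\<phi> x)) + t * indicator B x)"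
        using int(1) int_B by (intro Bochner_Integration.integrable_add integrable_mult_right)
      show "indicator B x * eta (cond_prob A (\<phi> x)) \<le>
          (- ln t - 1) * (indicator B x * cond_prob A (\<phi> x)) + t * indicator B x" for x
        using eta_le_tangent[OF cond_prob_bounds(1)[OF A, of "\<phi> x"] t]
        by (auto simp: indicator_def algebra_simps)
    qed (fact int(2))
    also have "\<dots> = (- ln t - 1) * m + t * \<beta>"
      using int(1) int_B integral_cond_prob_phi[OF A B] by (simp add: m_def \<beta>_def)
    also have "\<dots> = eta m + m * ln \<beta>"
      using pos by (simp add: t_def eta_def ln_div algebra_simps)
    finally show ?thesis
      by (simp add: m_def \<beta>_def)
  qed
qed

text \<open>The converse of Jensen's inequality up to an error. Where the conditional probability
  varies by at most \<open>d\<close>, its mean lies in the same interval, so \<open>eta\<close> of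
  the mean and \<open>eta\<close> of the function differ by at most \<open>e\<close> on
  \<open>B\<close>.\<close>

lemma integral_eta_cond_prob_ge:
  assumes A: "A \<in> R" and B: "B \<in> sets \<Theta>"
    and d: "\<And>y z. y \<in> {0..1} \<Longrightarrow> z \<in> {0..1} \<Longrightarrow> \<bar>y - z\<bar> \<le> d \<Longrightarrow> \<bar>eta y - eta z\<bar> \<le> e"
    and c: "\<And>x. x \<in> B \<Longrightarrow> c \<le> cond_prob A (\<phi> x) \<and> cond_prob A (\<phi> x) \<le> c + d"
  shows "eta (measure M (A \<inter> B)) + measure M (A \<inter> B) * ln (measure M B)
    \<le> (\<integral>x. indicator B x * eta (cond_prob A (\<phi> x)) \<partial>M) + e * measure M B"
proof -
  define m where "m = measure M (A \<inter> B)"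
  define \<beta> where "\<beta> = measure M B"
  have BM [measurable]: "B \<in> sets M"
    using B by (rule subalgebra_sets)
  have int_B: "integrable M (indicator B :: 'x \<Rightarrow> real)"
    using BM by (intro integrable_real_indicator) (auto simp: M.emeasure_eq_measure)
  have int: "integrable M (\<lambda>x. indicator B x * cond_prob A (\<phi> x))"
    "integrable M (\<lambda>x. indicator B x * eta (cond_prob A (\<phi> x)))"
    using A BM by (auto intro!: integrable_indicator_mult integrable_cond_prob_phi integrable_eta_cond_prob_phi)
  have m: "0 \<le> m" "m \<le> \<beta>" "m = (\<integral>x. indicator B x * cond_prob A (\<phi> x) \<partial>M)"
    using integral_cond_prob_phi[OF A B]
    by (auto simp: m_def \<beta>_def BM intro!: M.finite_measure_mono)
  show ?thesis
  proof (cases "\<beta> = 0")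
    case True
    have "0 \<le> (\<integral>x. indicator B x * eta (cond_prob A (\<phi> x)) \<partial>M)"
      using cond_prob_bounds[OF A] eta_nonneg by (intro integral_nonneg_AE) auto
    moreover have "measure M (A \<inter> B) = 0" "measure M B = 0"
      using m(1,2) True unfolding m_def \<beta>_def by linarith+
    ultimately show ?thesis
      by simp
  next
    case False
    then have \<beta>: "0 < \<beta>"
      by (auto simp: \<beta>_def less_le)
    have "c * \<beta> = (\<integral>x. c * indicator B x \<partial>M)"
      by (simp add: \<beta>_def)
    also have "\<dots> \<le> m"
      unfolding m(3) by (intro integral_mono integrable_mult_right int_B int(1)) (auto simp: indicator_def dest: c)
    finally have lo: "c \<le> m / \<beta>"
      using \<beta> by (simp add: pos_le_divide_eq)
    have "m \<le> (\<integral>x. (c + d) * indicator B x \<partial>M)"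
      unfolding m(3) by (intro integral_mono integrable_mult_right int_B int(1)) (auto simp: indicator_def dest: c)
    also have "\<dots> = (c + d) * \<beta>"
      by (simp add: \<beta>_def)
    finally have up: "m / \<beta> \<le> c + d"
      using \<beta> by (simp add: pos_divide_le_eq)
    have t: "m / \<beta> \<in> {0..1}"
      using m \<beta> by auto
    have close: "eta (m / \<beta>) - e \<le> eta (cond_prob A (\<phi> x))" if "x \<in> B" for x
      using d[OF t, of "cond_prob A (\<phi> x)"] c[OF that] lo up cond_prob_bounds[OF A, of "\<phi> x"]
      by (auto simp: abs_le_iff)
    have "(eta (m / \<beta>) - e) * \<beta> = (\<integral>x. (eta (m / \<beta>) - e) * indicator B x \<partial>M)"
      by (simp add: \<beta>_def)
    also have "\<dots> \<le> (\<integral>x. indicator B x * eta (cond_prob A (\<phi> x)) \<partial>M)"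
      by (intro integral_mono integrable_mult_right int_B int(2)) (auto simp: indicator_def dest: close)
    finally have "eta (m / \<beta>) * \<beta> \<le> (\<integral>x. indicator B x * eta (cond_prob A (\<phi> x)) \<partial>M) + e * \<beta>"
      by (simp add: algebra_simps)
    moreover have "eta (m / \<beta>) * \<beta> = eta m + m * ln \<beta>"
      using \<beta> m by (cases "m = 0") (auto simp: eta_def ln_div algebra_simps)
    ultimately show ?thesis
      by (simp add: m_def \<beta>_def)
  qed
qed

lemma integral_over_partition:
  assumes Q: "finite_partition M \<Theta> Q" and f: "integrable M (f :: 'x \<Rightarrow> real)"
  shows "(\<integral>x. f x \<partial>M) = (\<Sum>B\<in>Q. \<integral>x. indicator B x * f x \<partial>M)"
proof -
  have Q': "finite Q" "partition_on (space M) Q" "\<And>B. B \<in> Q \<Longrightarrow> B \<in> sets M"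
    using Q subalgebra_sets by (auto simp: finite_partition_def)
  have "(\<Sum>B\<in>Q. indicator B x) = (1::real)" if x: "x \<in> space M" for x
  proof -
    obtain B where B: "B \<in> Q" "x \<in> B"
      using Q'(2) x by (auto simp: partition_on_def)
    have "B' \<in> Q \<Longrightarrow> B' \<noteq> B \<Longrightarrow> x \<notin> B'" for B'
      using Q'(2) B by (auto simp: partition_on_def disjoint_def)
    then have "(\<Sum>B'\<in>Q. indicator B' x) = (\<Sum>B'\<in>Q. if B' = B then 1 else (0::real))"
      using B by (intro sum.cong) auto
    then show ?thesis
      using B Q'(1) by simp
  qed
  then have "(\<integral>x. f x \<partial>M) = (\<integral>x. (\<Sum>B\<in>Q. indicator B x * f x) \<partial>M)"
    by (intro Bochner_Integration.integral_cong) (auto simp flip: sum_distrib_right)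
  also have "\<dots> = (\<Sum>B\<in>Q. \<integral>x. indicator B x * f x \<partial>M)"
    using Q'(3) f by (intro Bochner_Integration.integral_sum integrable_indicator_mult)
  finally show ?thesis .
qed

lemma refinement_entropy_difference:
  assumes Q: "finite_partition M \<Theta> Q"
  shows "partition_entropy M (common_refinement {R, Q}) - partition_entropy M Q =
    (\<Sum>B\<in>Q. \<Sum>A\<in>R. eta (measure M (A \<inter> B)) + measure M (A \<inter> B) * ln (measure M B))"
proof -
  have Q': "finite Q" "partition_on (space M) Q" "\<And>B. B \<in> Q \<Longrightarrow> B \<in> sets M"
    using Q subalgebra_sets by (auto simp: finite_partition_def)
  have "partition_entropy M (common_refinement {R, Q}) = (\<Sum>C\<in>common_refinement {R, Q}. eta (measure M C))"
    by (simp add: partition_entropy_def eta_def sum_negf)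
  also have "\<dots> = (\<Sum>B\<in>Q. \<Sum>A\<in>R. eta (measure M (A \<inter> B)))"
    using partition_facts Q' by (intro sum_common_refinement_pair) auto
  finally have 1: "partition_entropy M (common_refinement {R, Q}) = (\<Sum>B\<in>Q. \<Sum>A\<in>R. eta (measure M (A \<inter> B)))" .
  have "- partition_entropy M Q = (\<Sum>B\<in>Q. measure M B * ln (measure M B))"
    by (simp add: partition_entropy_def)
  also have "\<dots> = (\<Sum>B\<in>Q. \<Sum>A\<in>R. measure M (A \<inter> B) * ln (measure M B))"
    using Q' by (intro sum.cong refl) (simp add: sum_partition_measure flip: sum_distrib_right)
  finally show ?thesis
    using 1 by (simp add: sum.distrib)
qed

text \<open>All conditional probabilities are rounded down to multiples of \<open>1 / k < d\<close>.
  The rounded values depend on \<open>r\<close> alone, so their level sets pull back into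
  \<open>\<Theta>\<close>, and there are finitely many because probabilities lie between 0 and
  1.\<close>

lemma ex_fine_partition:
  assumes d: "0 < d"
  shows "\<exists>Q. finite_partition M \<Theta> Q \<and>
    (\<forall>B\<in>Q. \<forall>A\<in>R. \<exists>c. \<forall>x\<in>B. c \<le> cond_prob A (\<phi> x) \<and> cond_prob A (\<phi> x) \<le> c + d)"
proof -
  obtain n :: nat where n: "inverse (real (Suc n)) < d"
    using reals_Archimedean[OF d] by auto
  define k where "k = real (Suc n)"
  have k: "0 < k" "1 / k < d"
    using n by (auto simp: k_def inverse_eq_divide)
  define F where "F r = (\<lambda>A\<in>R. \<lfloor>k * cond_prob A r\<rfloor>)" for r
  define Q where "Q = (\<lambda>v. (F \<circ> \<phi>) -` {v} \<inter> space M) ` (F \<circ> \<phi>) ` space M"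
  have F_range: "F r \<in> R \<rightarrow>\<^sub>E {0..int (Suc n)}" for r
  proof -
    have "\<lfloor>k * cond_prob A r\<rfloor> \<le> int (Suc n)" if "A \<in> R" for A
    proof -
      have "k * cond_prob A r \<le> k * 1"
        using cond_prob_bounds[OF that] k by (intro mult_left_mono) auto
      then have "k * cond_prob A r \<le> real_of_int (int (Suc n))"
        by (simp add: k_def)
      then show ?thesis by (simp add: floor_le_iff)
    qed
    moreover have "0 \<le> \<lfloor>k * cond_prob A r\<rfloor>" if "A \<in> R" for A
      using cond_prob_bounds(1)[OF that, of r] k by simp
    ultimately show ?thesis
      by (auto simp: F_def)
  qed
  have "finite (R \<rightarrow>\<^sub>E {0..int (Suc n)})"
    using partition_facts(1) by (intro finite_PiE) auto
  then have "finite ((F \<circ> \<phi>) ` space M)"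
    by (rule finite_subset[rotated]) (use F_range in auto)
  then have "finite Q"
    by (simp add: Q_def)
  moreover have "partition_on (space M) Q"
    unfolding Q_def by (rule partition_on_fibers)
  moreover have "Q \<subseteq> sets \<Theta>"
  proof
    fix B assume "B \<in> Q"
    then obtain y where y: "B = (F \<circ> \<phi>) -` {F (\<phi> y)} \<inter> space M"
      by (auto simp: Q_def)
    define v where "v = F (\<phi> y)"
    have v: "v \<in> extensional R" "B = (F \<circ> \<phi>) -` {v} \<inter> space M"
      using y by (auto simp: v_def F_def)
    have meas: "cond_prob A \<in> borel_measurable N" if "A \<in> R" for A
      using measurable_cond_prob partition_facts(3)[OF that] by blast
    have fib: "{r \<in> space N. \<lfloor>k * cond_prob A r\<rfloor> = v A} \<in> sets N" if "A \<in> R" for A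
      using meas[OF that] by measurable
    have "{r \<in> space N. \<forall>A\<in>R. \<lfloor>k * cond_prob A r\<rfloor> = v A} \<in> sets N"
      using fib partition_facts(1) by (intro sets.sets_Collect_finite_All) auto
    moreover have "{r \<in> space N. \<forall>A\<in>R. \<lfloor>k * cond_prob A r\<rfloor> = v A} = {r \<in> space N. F r = v}"
      using v(1) by (auto simp: F_def extensional_def fun_eq_iff)
    ultimately have "{r \<in> space N. F r = v} \<in> sets N"
      by simp
    moreover have "B = \<phi> -` {r \<in> space N. F r = v} \<inter> space M"
      using measurable_space[OF measurable_phi] by (auto simp: v)
    ultimately show "B \<in> sets \<Theta>"
      unfolding sets_\<Theta> by blast
  qed
  moreover have "\<exists>c. \<forall>x\<in>B. c \<le> cond_prob A (\<phi> x) \<and> cond_prob A (\<phi> x) \<le> c + d" if "B \<in> Q" "A \<in> R" for A B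
  proof -
    obtain v where v: "B = (F \<circ> \<phi>) -` {v} \<inter> space M"
      using \<open>B \<in> Q\<close> by (auto simp: Q_def)
    have "v A / k \<le> cond_prob A (\<phi> x) \<and> cond_prob A (\<phi> x) \<le> v A / k + d" if "x \<in> B" for x
    proof -
      have "\<lfloor>k * cond_prob A (\<phi> x)\<rfloor> = v A"
        using that \<open>A \<in> R\<close> by (auto simp: v F_def)
      then have "v A \<le> k * cond_prob A (\<phi> x)" "k * cond_prob A (\<phi> x) \<le> v A + 1"
        by linarith+
      then have "v A / k \<le> cond_prob A (\<phi> x)" "cond_prob A (\<phi> x) \<le> (v A + 1) / k"
        using k by (auto simp: field_simps)
      then show ?thesis
        using k by (simp add: add_divide_distrib)
    qed
    then show ?thesis by blast
  qed
  ultimately show ?thesis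
    unfolding finite_partition_def by blast
qed

text \<open>Jensen's inequality makes the integral a lower bound for every admissible
  \<open>Q\<close>, while partitions on which all conditional probabilities are nearly constant come
  arbitrarily close to it.\<close>

theorem cond_partition_entropy_eq_integral:
  "cond_partition_entropy M \<Theta> R = (\<integral>r. (\<Sum>A\<in>R. eta (cond_prob A r)) \<partial>N)"
proof -
  define I where "I = (\<integral>x. (\<Sum>A\<in>R. eta (cond_prob A (\<phi> x))) \<partial>M)"
  define h where "h Q = partition_entropy M (common_refinement {R, Q}) - partition_entropy M Q" for Q
  have meas: "(\<lambda>r. \<Sum>A\<in>R. eta (cond_prob A r)) \<in> borel_measurable N"
    using measurable_cond_prob partition_facts(3)
    by (intro borel_measurable_sum measurable_compose[OF _ borel_measurable_eta]) auto
  have I_N: "I = (\<integral>r. (\<Sum>A\<in>R. eta (cond_prob A r)) \<partial>N)"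
    unfolding I_def using meas by (subst (2) distr_phi[symmetric], subst integral_distr) auto
  have I_sum: "I = (\<Sum>B\<in>Q. \<Sum>A\<in>R. \<integral>x. indicator B x * eta (cond_prob A (\<phi> x)) \<partial>M)"
    if Q: "finite_partition M \<Theta> Q" for Q
  proof -
    have "I = (\<Sum>B\<in>Q. \<integral>x. indicator B x * (\<Sum>A\<in>R. eta (cond_prob A (\<phi> x))) \<partial>M)"
      unfolding I_def using integrable_eta_cond_prob_phi
      by (intro integral_over_partition[OF Q] Bochner_Integration.integrable_sum)
    also have "\<dots> = (\<Sum>B\<in>Q. \<Sum>A\<in>R. \<integral>x. indicator B x * eta (cond_prob A (\<phi> x)) \<partial>M)"
      unfolding sum_distrib_left using Q subalgebra_sets integrable_eta_cond_prob_phi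
      by (intro sum.cong refl Bochner_Integration.integral_sum integrable_indicator_mult)
        (auto simp: finite_partition_def)
    finally show ?thesis .
  qed
  have lower: "I \<le> h Q" if Q: "finite_partition M \<Theta> Q" for Q
    unfolding h_def refinement_entropy_difference[OF Q] I_sum[OF Q] using Q
    by (intro sum_mono integral_eta_cond_prob_le) (auto simp: finite_partition_def)
  \<comment> \<open>Shows that the infimum is over a nonempty set, as \<open>cINF_greatest\<close>
    requires.\<close>
  have trivial: "finite_partition M \<Theta> {space M}"
    using M.not_empty measurable_space[OF measurable_phi]
    by (auto simp: finite_partition_def partition_on_def disjoint_def sets_\<Theta> intro!: exI[of _ "space N"])
  have upper: "cond_partition_entropy M \<Theta> R \<le> I + e" if e: "0 < e" for e
  proof -
    \<comment> \<open>On each block the error \<open>e'\<close> times its mass occurs once per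
      \<open>A \<in> R\<close>, and the masses of the blocks sum to 1, so the total error is
      \<open>card R * e'\<close>. The \<open>+ 1\<close> keeps the denominator positive.\<close>
    define e' where "e' = e / (real (card R) + 1)"
    have e': "0 < e'" "e' * real (card R) \<le> e"
      using e by (auto simp: e'_def field_simps)
    have "uniformly_continuous_on {0..1} eta"
      by (intro compact_uniformly_continuous continuous_on_eta) simp
    then obtain d where d: "0 < d"
      "\<And>y z. y \<in> {0..1} \<Longrightarrow> z \<in> {0..1} \<Longrightarrow> dist y z < d \<Longrightarrow> dist (eta y) (eta z) < e'"
      using e' unfolding uniformly_continuous_on_def by metis
    \<comment> \<open>Half of \<open>d\<close>, because uniform continuity speaks of distances
      \<open>< d\<close> whereas the blocks bound the oscillation by \<open>\<le>\<close>.\<close>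
    obtain Q where Q: "finite_partition M \<Theta> Q"
      and fine: "\<And>B A. B \<in> Q \<Longrightarrow> A \<in> R \<Longrightarrow>
        \<exists>c. \<forall>x\<in>B. c \<le> cond_prob A (\<phi> x) \<and> cond_prob A (\<phi> x) \<le> c + d / 2"
      using ex_fine_partition[of "d / 2"] d by auto
    have Q\<Theta>: "B \<in> Q \<Longrightarrow> B \<in> sets \<Theta>" for B
      using Q by (auto simp: finite_partition_def)
    have "h Q \<le> (\<Sum>B\<in>Q. \<Sum>A\<in>R. (\<integral>x. indicator B x * eta (cond_prob A (\<phi> x)) \<partial>M) + e' * measure M B)"
      unfolding h_def refinement_entropy_difference[OF Q]
    proof (intro sum_mono)
      fix B A assume BA: "B \<in> Q" "A \<in> R"
      obtain c where c: "\<And>x. x \<in> B \<Longrightarrow> c \<le> cond_prob A (\<phi> x) \<and> cond_prob A (\<phi> x) \<le> c + d / 2"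
        using fine[OF BA] by blast
      show "eta (measure M (A \<inter> B)) + measure M (A \<inter> B) * ln (measure M B)
        \<le> (\<integral>x. indicator B x * eta (cond_prob A (\<phi> x)) \<partial>M) + e' * measure M B"
      proof (rule integral_eta_cond_prob_ge[OF BA(2) Q\<Theta>[OF BA(1)] _ c])
        fix y z :: real assume "y \<in> {0..1}" "z \<in> {0..1}" "\<bar>y - z\<bar> \<le> d / 2"
        then show "\<bar>eta y - eta z\<bar> \<le> e'"
          using d(2)[of y z] d(1) by (simp add: dist_real_def)
      qed
    qed
    also have "\<dots> = I + real (card R) * e' * (\<Sum>B\<in>Q. measure M B)"
      by (simp add: sum.distrib I_sum[OF Q] sum_distrib_left mult.assoc)
    also have "(\<Sum>B\<in>Q. measure M B) = 1"
    proof -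
      have "(\<integral>x. (1::real) \<partial>M) = (\<Sum>B\<in>Q. \<integral>x. indicator B x * (1::real) \<partial>M)"
        by (rule integral_over_partition[OF Q]) simp
      moreover have "(\<integral>x. indicator B x * (1::real) \<partial>M) = measure M B" if "B \<in> Q" for B
        using subalgebra_sets[OF Q\<Theta>[OF that]] by simp
      ultimately show ?thesis
        by (simp add: M.prob_space)
    qed
    finally have "h Q \<le> I + e"
      using e' by (simp add: mult.commute)
    moreover have "cond_partition_entropy M \<Theta> R \<le> h Q"
      unfolding cond_partition_entropy_def h_def[symmetric] using lower Q
      by (intro cINF_lower bdd_belowI2[of _ I]) auto
    ultimately show ?thesis by linarith
  qed
  have "I \<le> cond_partition_entropy M \<Theta> R"
    unfolding cond_partition_entropy_def h_def[symmetric] using lower trivial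
    by (intro cINF_greatest) auto
  moreover have "cond_partition_entropy M \<Theta> R \<le> I"
    using upper by (rule field_le_epsilon)
  ultimately show ?thesis
    by (simp add: I_N)
qed

end

end

section \<open>Multiordered systems\<close>

locale multiordered =
  fixes M :: "'x measure"
    and T :: "'g::{group_add, countable} \<Rightarrow> 'x \<Rightarrow> 'x"
    and \<nu> :: "('g \<Rightarrow> 'g \<Rightarrow> bool) measure"
    and \<phi> :: "'x \<Rightarrow> 'g \<Rightarrow> 'g \<Rightarrow> bool"
    and P :: "'x set set"
  assumes prob_M: "prob_space M"
    and T_action: "mp_action M T"
    and \<nu>: "multiorder \<nu>"
    and factor: "factor_map M T \<nu> act_order \<phi>"
    and P: "finite_partition M M P"
begin

sublocale prob_factor M \<nu> \<phi>
  using prob_M \<nu> factor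
  by (intro prob_factor.intro prob_factor_axioms.intro) (auto simp: multiorder_def factor_map_def)

lemma sets_nu: "sets \<nu> = sets orders_Z_borel"
  using \<nu> by (simp add: multiorder_def)

lemma space_nu [simp]: "space \<nu> = orders_Z"
  using sets_eq_imp_space_eq[OF sets_nu] by simp

lemma measurable_nu: "f \<in> measurable orders_Z_borel N \<Longrightarrow> f \<in> measurable \<nu> N"
  by (simp add: measurable_cong_sets[OF sets_nu refl])

lemma measurable_order_enum_nu [measurable]: "(\<lambda>r. order_enum r i) \<in> measurable \<nu> (count_space UNIV)"
  by (rule measurable_nu) (rule measurable_order_enum)

lemma measurable_rel_nu [measurable]: "Measurable.pred \<nu> (\<lambda>r. r a b)"
  by (rule measurable_nu) (rule measurable_orders_Z_rel)

lemma T_preserving: "measure_preserving M M (T g)"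
  and T_0: "x \<in> space M \<Longrightarrow> T 0 x = x"
  and T_add: "x \<in> space M \<Longrightarrow> T (g + h) x = T g (T h x)"
  using T_action by (auto simp: mp_action_def)

lemma measurable_T [measurable]: "T g \<in> measurable M M"
  using T_preserving by (auto simp: measure_preserving_def)

lemma T_space: "x \<in> space M \<Longrightarrow> T g x \<in> space M"
  using measurable_space[OF measurable_T] .

lemma act_preserving: "measure_preserving \<nu> \<nu> (act_order g)"
  using \<nu> by (auto simp: multiorder_def mp_action_def)

lemma measurable_act [measurable]: "act_order g \<in> measurable \<nu> \<nu>"
  using act_preserving by (auto simp: measure_preserving_def)

lemma act_act: "act_order g (act_order h r) = act_order (g + h) r"
  by (simp add: act_order_def add.assoc)

lemma act_0 [simp]: "act_order 0 r = r"
  by (simp add: act_order_def)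

lemma phi_equivariant: "AE x in M. \<forall>g. \<phi> (T g x) = act_order g (\<phi> x)"
  using factor by (simp add: factor_map_def)

lemma P_facts: "finite P" "partition_on (space M) P" "A \<in> P \<Longrightarrow> A \<in> sets M"
  using P by (auto simp: finite_partition_def)

lemma phi_orders_Z: "x \<in> space M \<Longrightarrow> \<phi> x \<in> orders_Z"
  using measurable_space[OF measurable_phi] by simp

lemma sets_orders_algebra: "sets (orders_algebra M \<phi>) = {\<phi> -` b \<inter> space M |b. b \<in> sets \<nu>}"
  using phi_orders_Z unfolding orders_algebra_def
  by (subst sets_vimage_algebra2) (auto simp: sets_nu)

subsection \<open>Names of a process\<close>

text \<open>The index type is free because names are read both along the group and along the
  iterates of the successor map. Cells may be empty.\<close>

definition cell :: "('i \<Rightarrow> 'x \<Rightarrow> 'x) \<Rightarrow> 'i set \<Rightarrow> ('i \<Rightarrow> 'x set) \<Rightarrow> 'x set" where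
  "cell Y E w = {x \<in> space M. \<forall>i\<in>E. Y i x \<in> w i}"

lemma sets_cell:
  assumes "finite E" "\<And>i. i \<in> E \<Longrightarrow> Y i \<in> measurable M M" "w \<in> E \<rightarrow>\<^sub>E P"
  shows "cell Y E w \<in> sets M"
  unfolding cell_def
proof (rule sets.sets_Collect_finite_All[OF _ \<open>finite E\<close>])
  fix i assume i: "i \<in> E"
  then have "Y i -` w i \<inter> space M \<in> sets M"
    using assms P_facts(3)[of "w i"] by (intro measurable_sets[of _ M M]) auto
  then show "{x \<in> space M. Y i x \<in> w i} \<in> sets M"
    by (simp add: vimage_def Int_def conj_commute)
qed

lemma cond_entropy_iterated_partition:
  assumes E: "finite E" "E \<noteq> {}" and Y: "\<And>i. i \<in> E \<Longrightarrow> Y i \<in> measurable M M"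
  shows "cond_partition_entropy M (orders_algebra M \<phi>) (iterated_partition M Y P E) =
    (\<integral>r. (\<Sum>w\<in>E \<rightarrow>\<^sub>E P. eta (cond_prob (cell Y E w) r)) \<partial>\<nu>)"
proof -
  define g where "g i A = Y i -` A \<inter> space M" for i A
  define Q where "Q i = preimage_partition M (Y i) P" for i
  define R where "R = iterated_partition M Y P E"
  have cell: "(\<Inter>i\<in>E. g i (w i)) = cell Y E w" for w
    using E(2) by (auto simp: g_def cell_def)
  have Y_space: "Y i x \<in> space M" if "i \<in> E" "x \<in> space M" for i x
    using Y that by (meson measurable_space)
  have Q: "Q i = g i ` P - {{}}" for i
    by (auto simp: Q_def g_def preimage_partition_def)
  have disj: "g i a \<inter> g i b = {}" if "a \<in> P" "b \<in> P" "a \<noteq> b" for i a b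
    using P_facts(2) that by (auto simp: g_def partition_on_def disjoint_def)
  have R_Q: "R = common_refinement (Q ` E)"
    by (simp add: R_def Q_def iterated_partition_def)
  have R_eq: "R = cell Y E ` (E \<rightarrow>\<^sub>E P) - {{}}"
    unfolding R_Q
    by (subst sum_common_refinement(2)[where g = g and S = "\<lambda>_. P" and f = "\<lambda>_. 0"])
      (use E Q disj P_facts(1) in \<open>auto simp: cell\<close>)
  have "partition_on (space M) (Q i)" if "i \<in> E" for i
  proof (rule partition_onI)
    show "\<Union> (Q i) = space M"
    proof -
      have "\<Union> (Q i) = Y i -` \<Union> P \<inter> space M"
        by (auto simp: Q g_def)
      then show ?thesis
        using P_facts(2) Y_space[OF that] by (auto simp: partition_on_def)
    qed
    show "disjnt p q" if "p \<in> Q i" "q \<in> Q i" "p \<noteq> q" for p q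
      using that disj unfolding Q disjnt_def by blast
    show "{} \<notin> Q i"
      by (simp add: Q)
  qed
  then have "partition_on (space M) R"
    unfolding R_Q using E(2) by (intro partition_on_common_refinement) auto
  moreover have "finite R"
    unfolding R_eq using E(1) P_facts(1) by (auto intro!: finite_PiE)
  moreover have "R \<subseteq> sets M"
    unfolding R_eq using sets_cell[OF E(1) Y] by auto
  ultimately have fR: "finite_partition M M R"
    by (simp add: finite_partition_def)
  have meas: "(\<lambda>r. eta (cond_prob A r)) \<in> borel_measurable \<nu>" if "A \<in> sets M" for A
    using measurable_compose[OF measurable_cond_prob[OF that] borel_measurable_eta] .
  \<comment> \<open>Even \<open>cond_prob {}\<close> is a chosen version and vanishes only almost
    everywhere; this is \<open>cond_prob_sum\<close> for the empty family.\<close>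
  have "AE r in \<nu>. cond_prob {} r = 0"
    using cond_prob_sum[of "{}" "\<lambda>_::nat. {}"] by (simp add: disjoint_family_on_def)
  then have ae: "AE r in \<nu>. (\<Sum>A\<in>R. eta (cond_prob A r)) = (\<Sum>w\<in>E \<rightarrow>\<^sub>E P. eta (cond_prob (cell Y E w) r))"
  proof eventually_elim
    case (elim r)
    show ?case
      unfolding R_Q cell[symmetric] using E Q disj P_facts(1) elim
      by (intro sum_common_refinement(1)) auto
  qed
  have "cond_partition_entropy M (orders_algebra M \<phi>) R = (\<integral>r. (\<Sum>A\<in>R. eta (cond_prob A r)) \<partial>\<nu>)"
    by (rule cond_partition_entropy_eq_integral[OF sets_orders_algebra fR])
  also have "\<dots> = (\<integral>r. (\<Sum>w\<in>E \<rightarrow>\<^sub>E P. eta (cond_prob (cell Y E w) r)) \<partial>\<nu>)"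
    using ae \<open>R \<subseteq> sets M\<close> sets_cell[OF E(1) Y]
    by (intro integral_cong_AE borel_measurable_sum meas) auto
  finally show ?thesis
    by (simp add: R_def)
qed

lemma sum_cells_reindex:
  fixes a :: "'i \<Rightarrow> 'g" and f :: "'x set \<Rightarrow> real"
  assumes inj: "inj_on a E"
  shows "(\<Sum>w\<in>E \<rightarrow>\<^sub>E P. f (cell (\<lambda>i. T (a i)) E w)) = (\<Sum>w\<in>a ` E \<rightarrow>\<^sub>E P. f (cell T (a ` E) w))"
proof (rule sum.reindex_bij_witness[where
      i = "\<lambda>v. \<lambda>k\<in>E. v (a k)" and j = "\<lambda>w. \<lambda>g\<in>a ` E. w (inv_into E a g)"])
  fix w assume w: "w \<in> E \<rightarrow>\<^sub>E P"
  show "(\<lambda>k\<in>E. (\<lambda>g\<in>a ` E. w (inv_into E a g)) (a k)) = w"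
    using w inj by (intro extensionalityI[of _ E]) (auto simp: PiE_def)
  show "(\<lambda>g\<in>a ` E. w (inv_into E a g)) \<in> a ` E \<rightarrow>\<^sub>E P"
    using w inj by auto
  show "f (cell T (a ` E) (\<lambda>g\<in>a ` E. w (inv_into E a g))) = f (cell (\<lambda>i. T (a i)) E w)"
    using inj by (intro arg_cong[of _ _ f]) (auto simp: cell_def)
next
  fix v assume v: "v \<in> a ` E \<rightarrow>\<^sub>E P"
  show "(\<lambda>g\<in>a ` E. (\<lambda>k\<in>E. v (a k)) (inv_into E a g)) = v"
    using v inj by (intro extensionalityI[of _ "a ` E"]) (auto simp: PiE_def)
  show "(\<lambda>k\<in>E. v (a k)) \<in> E \<rightarrow>\<^sub>E P"
    using v by auto
qed

section \<open>Entropies of names in the fibres over the orders\<close>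

definition fib_ent :: "('g \<Rightarrow> 'g \<Rightarrow> bool) \<Rightarrow> 'g set \<Rightarrow> real" where
  "fib_ent r = ent P (\<lambda>E w. cond_prob (cell T E w) r)"

text \<open>The versions of the conditional probabilities are chosen event by event, so each
  additivity relation has its own null set. There are countably many relations, hence almost every
  \<open>r\<close> satisfies all of them.\<close>

lemma AE_marginals: "AE r in \<nu>. marginals P (\<lambda>E w. cond_prob (cell T E w) r)"
proof -
  have "AE r in \<nu>. \<forall>E\<in>{E. finite E}. \<forall>g. \<forall>w\<in>E \<rightarrow>\<^sub>E P. g \<notin> E \<longrightarrow>
      (\<Sum>a\<in>P. cond_prob (cell T (insert g E) (w(g := a))) r) = cond_prob (cell T E w) r"
    unfolding AE_ball_countable[OF countable_Collect_finite] AE_all_countable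
  proof (intro ballI allI)
    fix E :: "'g set" and g assume E: "E \<in> {E. finite E}"
    show "AE r in \<nu>. \<forall>w\<in>E \<rightarrow>\<^sub>E P. g \<notin> E \<longrightarrow>
      (\<Sum>a\<in>P. cond_prob (cell T (insert g E) (w(g := a))) r) = cond_prob (cell T E w) r"
    proof (rule AE_finite_allI)
      show "finite (E \<rightarrow>\<^sub>E P)"
        using E P_facts by (auto intro: finite_PiE)
      fix w assume w: "w \<in> E \<rightarrow>\<^sub>E P"
      show "AE r in \<nu>. g \<notin> E \<longrightarrow>
        (\<Sum>a\<in>P. cond_prob (cell T (insert g E) (w(g := a))) r) = cond_prob (cell T E w) r"
      proof (cases "g \<in> E")
        case False
        let ?C = "\<lambda>a. cell T (insert g E) (w(g := a))"
        have C: "?C a = cell T E w \<inter> {x \<in> space M. T g x \<in> a}" for a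
          using False by (auto simp: cell_def)
        have "AE r in \<nu>. cond_prob (\<Union>a\<in>P. ?C a) r = (\<Sum>a\<in>P. cond_prob (?C a) r)"
        proof (rule cond_prob_sum)
          show "?C a \<in> sets M" if "a \<in> P" for a
            using E w that by (intro sets_cell) (auto simp: PiE_def extensional_def)
          show "disjoint_family_on ?C P"
            using P_facts(2) unfolding C disjoint_family_on_def partition_on_def disjoint_def by blast
        qed (rule P_facts)
        moreover have "(\<Union>a\<in>P. ?C a) = cell T E w"
        proof -
          have "(\<Union>a\<in>P. ?C a) = cell T E w \<inter> {x \<in> space M. T g x \<in> \<Union> P}"
            unfolding C by auto
          then show ?thesis
            using P_facts(2) T_space by (auto simp: cell_def partition_on_def)
        qed
        ultimately show ?thesis by auto
      qed simp
    qed
  qed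
  then show ?thesis
    using cond_prob_space
  proof eventually_elim
    case (elim r)
    show ?case
    proof
      show "0 \<le> cond_prob (cell T E w) r" if "finite E" "w \<in> E \<rightarrow>\<^sub>E P" for E w
        using that by (intro cond_prob_nonneg sets_cell) auto
      show "cond_prob (cell T {} (\<lambda>_. undefined)) r = 1"
        using elim by (simp add: cell_def)
    qed (use elim P_facts in auto)
  qed
qed

text \<open>By the action law, \<open>T g x\<close> has the name \<open>w\<close> over
  \<open>E\<close> iff \<open>x\<close> has the same name over the right translate of
  \<open>E\<close> by \<open>g\<close>. The fibre of \<open>x\<close> moves accordingly by
  \<open>act_order g\<close>, with inverse \<open>act_order (- g)\<close>.\<close>

lemma AE_fib_ent_equivariant:
  "AE r in \<nu>. \<forall>E\<in>{E. finite E}. \<forall>g. fib_ent r ((\<lambda>h. h + g) ` E) = fib_ent (act_order g r) E"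
  unfolding AE_ball_countable[OF countable_Collect_finite] AE_all_countable
proof (intro ballI allI)
  fix E :: "'g set" and g assume E: "E \<in> {E. finite E}"
  have "AE r in \<nu>. \<forall>w\<in>E \<rightarrow>\<^sub>E P. cond_prob (cell (\<lambda>h. T (h + g)) E w) r = cond_prob (cell T E w) (act_order g r)"
  proof (rule AE_finite_allI)
    show "finite (E \<rightarrow>\<^sub>E P)"
      using E P_facts by (auto intro: finite_PiE)
    fix w assume w: "w \<in> E \<rightarrow>\<^sub>E P"
    have "AE r in \<nu>. cond_prob (T g -` cell T E w \<inter> space M) r = cond_prob (cell T E w) (act_order g r)"
    proof (rule cond_prob_equivariant)
      show "cell T E w \<in> sets M"
        using E w by (intro sets_cell) auto
      show "AE x in M. \<phi> (T g x) = act_order g (\<phi> x)"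
        using phi_equivariant by eventually_elim auto
      show "act_order (- g) (act_order g r) = r" for r
        by (simp add: act_act)
    qed (auto intro: T_preserving act_preserving measurable_act)
    moreover have "T g -` cell T E w \<inter> space M = cell (\<lambda>h. T (h + g)) E w"
      by (auto simp: cell_def T_add T_space)
    ultimately show "AE r in \<nu>. cond_prob (cell (\<lambda>h. T (h + g)) E w) r = cond_prob (cell T E w) (act_order g r)"
      by simp
  qed
  then show "AE r in \<nu>. fib_ent r ((\<lambda>h. h + g) ` E) = fib_ent (act_order g r) E"
  proof eventually_elim
    case (elim r)
    have "fib_ent r ((\<lambda>h. h + g) ` E) = (\<Sum>w\<in>E \<rightarrow>\<^sub>E P. eta (cond_prob (cell (\<lambda>h. T (h + g)) E w) r))"
      unfolding fib_ent_def ent_def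
      by (rule sum_cells_reindex[symmetric, of _ _ "\<lambda>A. eta (cond_prob A r)"]) (auto simp: inj_on_def)
    also have "\<dots> = fib_ent (act_order g r) E"
      unfolding fib_ent_def ent_def using elim by (intro sum.cong) auto
    finally show ?case .
  qed
qed

text \<open>A countable group has countably many finite subsets, so the random set
  \<open>D r\<close> cuts the space of orders into countably many pieces, on each of which it is a
  constant \<open>E\<close>.\<close>

lemma measurable_fib_ent:
  assumes fin: "\<And>r. r \<in> orders_Z \<Longrightarrow> finite (D r)"
    and D: "\<And>g. Measurable.pred \<nu> (\<lambda>r. g \<in> D r)"
  shows "(\<lambda>r. fib_ent r (D r)) \<in> borel_measurable \<nu>"
proof (rule measurable_compose_countable'[where I = "{E. finite E}"])
  show "countable {E :: 'g set. finite E}"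
    by (rule countable_Collect_finite)
  show "(\<lambda>r. fib_ent r E) \<in> borel_measurable \<nu>" if "E \<in> {E. finite E}" for E
    unfolding fib_ent_def ent_def using that sets_cell[of E T]
    by (intro borel_measurable_sum measurable_compose[OF measurable_cond_prob borel_measurable_eta]) auto
  show "D \<in> measurable \<nu> (count_space {E. finite E})"
  proof (rule measurable_count_space_eq_countable[THEN iffD2, OF countable_Collect_finite], intro conjI ballI)
    fix E
    have "{r \<in> space \<nu>. \<forall>g. g \<in> D r \<longleftrightarrow> g \<in> E} \<in> sets \<nu>"
      using D by measurable
    moreover have "D -` {E} \<inter> space \<nu> = {r \<in> space \<nu>. \<forall>g. g \<in> D r \<longleftrightarrow> g \<in> E}"
      by auto
    ultimately show "D -` {E} \<inter> space \<nu> \<in> sets \<nu>"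
      by simp
  qed (use fin in auto)
qed

subsection \<open>Chain rule for the action of the group\<close>

text \<open>One exceptional null set for all \<open>E\<close> and \<open>g\<close> at once. This is
  essential, since the sets inserted later, such as the predecessors of an element in
  \<open>D\<close>, depend on \<open>r\<close>.\<close>

definition good :: "('g \<Rightarrow> 'g \<Rightarrow> bool) \<Rightarrow> bool" where
  "good r \<longleftrightarrow> r \<in> orders_Z \<and> marginals P (\<lambda>E w. cond_prob (cell T E w) r) \<and>
     (\<forall>E g. finite E \<longrightarrow> fib_ent r ((\<lambda>h. h + g) ` E) = fib_ent (act_order g r) E)"

lemma AE_good: "AE r in \<nu>. good r"
  using AE_marginals AE_fib_ent_equivariant AE_space
  by eventually_elim (simp add: good_def)

text \<open>
  \<open>incr r E\<close> is the entropy, in the fibre over \<open>r\<close>, of \<open>P\<close> given its names over \<open>E\<close>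
  (for \<open>0 \<notin> E\<close>).
\<close>

definition incr :: "('g \<Rightarrow> 'g \<Rightarrow> bool) \<Rightarrow> 'g set \<Rightarrow> real" where
  "incr r E = fib_ent r (insert 0 E) - fib_ent r E"

lemma incr_nonneg: "good r \<Longrightarrow> finite E \<Longrightarrow> 0 \<le> incr r E"
  using marginals.ent_mono_insert[of P "\<lambda>E w. cond_prob (cell T E w) r" E 0]
  by (simp add: good_def incr_def fib_ent_def)

lemma incr_le: "good r \<Longrightarrow> finite E \<Longrightarrow> 0 \<notin> E \<Longrightarrow> incr r E \<le> card P"
  using marginals.ent_increment_le[of P "\<lambda>E w. cond_prob (cell T E w) r" E 0]
  by (simp add: good_def incr_def fib_ent_def)

lemma incr_antimono: "good r \<Longrightarrow> finite E' \<Longrightarrow> 0 \<notin> E' \<Longrightarrow> E \<subseteq> E' \<Longrightarrow> incr r E' \<le> incr r E"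
  using marginals.ent_increment_antimono[of P "\<lambda>E w. cond_prob (cell T E w) r" E' E 0]
  by (simp add: good_def incr_def fib_ent_def)

lemma fib_ent_increment:
  assumes "good r" "finite E"
  shows "fib_ent r (insert g ((\<lambda>h. h + g) ` E)) - fib_ent r ((\<lambda>h. h + g) ` E) = incr (act_order g r) E"
proof -
  have "insert g ((\<lambda>h. h + g) ` E) = (\<lambda>h. h + g) ` insert 0 E"
    by simp
  then show ?thesis
    using assms by (simp add: good_def incr_def del: image_insert)
qed

lemma fib_ent_chain:
  assumes r: "good r" and D: "finite D"
  shows "fib_ent r D = (\<Sum>g\<in>D. fib_ent r (insert g {h\<in>D. r h g}) - fib_ent r {h\<in>D. r h g})"
proof -
  have "fib_ent r {} = 0"
    using r unfolding good_def fib_ent_def by (blast intro: marginals.ent_empty)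
  moreover have "irreflp r" "transp r" "totalp r"
    using r by (auto simp: good_def orders_Z_def)
  ultimately show ?thesis
    using sum_increments_along_order[OF D, of r "fib_ent r"] by simp
qed

lemma measurable_incr:
  assumes "\<And>r. r \<in> orders_Z \<Longrightarrow> finite (D r)" "\<And>g. Measurable.pred \<nu> (\<lambda>r. g \<in> D r)"
  shows "(\<lambda>r. incr r (D r)) \<in> borel_measurable \<nu>"
  unfolding incr_def
proof (intro borel_measurable_diff measurable_fib_ent)
  have [measurable]: "\<And>g. Measurable.pred \<nu> (\<lambda>r. g \<in> D r)"
    by (rule assms)
  show "Measurable.pred \<nu> (\<lambda>r. g \<in> insert 0 (D r))" for g
    unfolding insert_iff by measurable
qed (use assms in auto)

lemma integrable_incr:
  assumes "\<And>r. r \<in> orders_Z \<Longrightarrow> finite (D r)" "\<And>g. Measurable.pred \<nu> (\<lambda>r. g \<in> D r)"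
    and "\<And>r. r \<in> orders_Z \<Longrightarrow> 0 \<notin> D r"
  shows "integrable \<nu> (\<lambda>r. incr r (D r))"
proof (rule N.integrable_const_bound[of _ "card P"])
  show "AE r in \<nu>. norm (incr r (D r)) \<le> card P"
    using AE_good
  proof eventually_elim
    case (elim r)
    then have "r \<in> orders_Z" by (simp add: good_def)
    with elim show ?case
      using assms incr_nonneg[of r "D r"] incr_le[of r "D r"] by simp
  qed
qed (rule measurable_incr[OF assms(1,2)])

text \<open>Both chain rules evaluate increments at a recentred order \<open>u r\<close>; invariance
  removes the recentring after integration, with \<open>u\<close> being \<open>act_order g\<close>
  or \<open>shift i\<close>.\<close>

lemma incr_comp:
  assumes "\<And>r. r \<in> orders_Z \<Longrightarrow> finite (D r)" "\<And>g. Measurable.pred \<nu> (\<lambda>r. g \<in> D r)"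
    and "\<And>r. r \<in> orders_Z \<Longrightarrow> 0 \<notin> D r" and u: "measure_preserving \<nu> \<nu> u"
  shows "integrable \<nu> (\<lambda>r. incr (u r) (D (u r)))"
    and "(\<integral>r. incr (u r) (D (u r)) \<partial>\<nu>) = (\<integral>r. incr r (D r) \<partial>\<nu>)"
proof -
  have "u \<in> measurable \<nu> \<nu>" and du: "distr \<nu> \<nu> u = \<nu>"
    using u by (auto simp: measure_preserving_def)
  then show "integrable \<nu> (\<lambda>r. incr (u r) (D (u r)))"
    using integrable_incr[OF assms(1,2,3)] integrable_distr[of u \<nu> \<nu> "\<lambda>r. incr r (D r)"] by simp
  show "(\<integral>r. incr (u r) (D (u r)) \<partial>\<nu>) = (\<integral>r. incr r (D r) \<partial>\<nu>)"
    using integral_distr[OF \<open>u \<in> measurable \<nu> \<nu>\<close> measurable_incr[OF assms(1,2)]] du by simp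
qed

definition past :: "'g set \<Rightarrow> ('g \<Rightarrow> 'g \<Rightarrow> bool) \<Rightarrow> 'g set" where
  "past K r = {k\<in>K. r k 0}"

lemma past_props:
  assumes "finite K"
  shows "r \<in> orders_Z \<Longrightarrow> finite (past K r)" "Measurable.pred \<nu> (\<lambda>r. g \<in> past K r)"
    "r \<in> orders_Z \<Longrightarrow> 0 \<notin> past K r"
proof -
  show "Measurable.pred \<nu> (\<lambda>r. g \<in> past K r)"
    unfolding past_def mem_Collect_eq by measurable
qed (use assms orders_ZD(1)[of r 0] in \<open>auto simp: past_def\<close>)

text \<open>The conditional entropy of \<open>P\<close> given the order and the names over that part
  of \<open>K\<close> which precedes the unit. It plays the role of \<open>a\<close> in
  \<open>folner_average\<close>.\<close>

definition gain :: "'g set \<Rightarrow> real" where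
  "gain K = (\<integral>r. incr r (past K r) \<partial>\<nu>)"

lemma cond_entropy_T:
  assumes D: "finite D" "D \<noteq> {}"
  shows "cond_partition_entropy M (orders_algebra M \<phi>) (iterated_partition M T P D) =
    (\<Sum>g\<in>D. gain ((\<lambda>d. d - g) ` D))"
proof -
  let ?K = "\<lambda>g. (\<lambda>d. d - g) ` D"
  have K: "finite (?K g)" for g
    using D by simp
  have "cond_partition_entropy M (orders_algebra M \<phi>) (iterated_partition M T P D) = (\<integral>r. fib_ent r D \<partial>\<nu>)"
    unfolding fib_ent_def ent_def by (rule cond_entropy_iterated_partition[OF D measurable_T])
  also have "\<dots> = (\<integral>r. (\<Sum>g\<in>D. incr (act_order g r) (past (?K g) (act_order g r))) \<partial>\<nu>)"
  proof (rule integral_cong_AE)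
    show "(\<lambda>r. fib_ent r D) \<in> borel_measurable \<nu>"
      using D by (intro measurable_fib_ent) auto
    show "(\<lambda>r. \<Sum>g\<in>D. incr (act_order g r) (past (?K g) (act_order g r))) \<in> borel_measurable \<nu>"
      using past_props[OF K]
      by (intro borel_measurable_sum borel_measurable_integrable incr_comp act_preserving) auto
    show "AE r in \<nu>. fib_ent r D = (\<Sum>g\<in>D. incr (act_order g r) (past (?K g) (act_order g r)))"
      using AE_good
    proof eventually_elim
      case (elim r)
      \<comment> \<open>Recentring at \<open>g\<close> turns the predecessors of \<open>g\<close>
        into predecessors of the unit: \<open>r h g\<close> holds iff
        \<open>act_order g r (h - g) 0\<close>.\<close>
      have "{h \<in> D. r h g} = (\<lambda>h. h + g) ` past (?K g) (act_order g r)" for g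
        by (force simp: past_def act_order_def image_iff)
      then have "fib_ent r (insert g {h\<in>D. r h g}) - fib_ent r {h\<in>D. r h g} =
          incr (act_order g r) (past (?K g) (act_order g r))" for g
        using fib_ent_increment[OF elim, of "past (?K g) (act_order g r)" g] K by (simp add: past_def)
      then show ?case
        unfolding fib_ent_chain[OF elim D(1)] by simp
    qed
  qed
  also have "\<dots> = (\<Sum>g\<in>D. \<integral>r. incr (act_order g r) (past (?K g) (act_order g r)) \<partial>\<nu>)"
    using past_props[OF K] by (intro Bochner_Integration.integral_sum incr_comp act_preserving) auto
  also have "\<dots> = (\<Sum>g\<in>D. gain (?K g))"
    unfolding gain_def using past_props[OF K] by (intro sum.cong refl incr_comp act_preserving) auto
  finally show ?thesis .
qed

subsection \<open>Chain rule for the successor map\<close>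

text \<open>The map that the \<open>i\<close>-th power of the successor map induces on orders: an
  order is recentred at its \<open>i\<close>-th element.\<close>

definition shift :: "int \<Rightarrow> ('g \<Rightarrow> 'g \<Rightarrow> bool) \<Rightarrow> 'g \<Rightarrow> 'g \<Rightarrow> bool" where
  "shift i r = act_order (order_enum r i) r"

lemma order_enum_shift: "r \<in> orders_Z \<Longrightarrow> order_enum (shift i r) k = order_enum r (k + i) - order_enum r i"
  by (simp add: shift_def order_enum_act_order)

lemma shift_orders_Z: "r \<in> orders_Z \<Longrightarrow> shift i r \<in> orders_Z"
  by (simp add: shift_def act_order_orders_Z)

lemma measurable_shift [measurable]: "shift i \<in> measurable \<nu> \<nu>"
  unfolding shift_def[abs_def]
  by (rule measurable_compose_countable[OF measurable_act measurable_order_enum_nu])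

text \<open>
  The part of \<open>shift i\<close> on which it acts as \<open>g\<close> is carried by \<open>g\<close> onto the part of
  \<open>shift (- i)\<close> on which that map acts as \<open>- g\<close>.
\<close>

lemma shift_preserving: "measure_preserving \<nu> \<nu> (shift i)"
  unfolding measure_preserving_def
proof
  show "distr \<nu> \<nu> (shift i) = \<nu>"
  proof (rule measure_eqI)
    fix b assume "b \<in> sets (distr \<nu> \<nu> (shift i))"
    then have b[measurable]: "b \<in> sets \<nu>" by simp
    define A where "A g = {r \<in> space \<nu>. order_enum r i = g \<and> act_order g r \<in> b}" for g
    define B where "B g = {r \<in> space \<nu>. order_enum r (- i) = - g \<and> r \<in> b}" for g
    have [measurable]: "B g \<in> sets \<nu>" for g
      unfolding B_def by measurable
    have disj: "disjoint_family_on A UNIV" "disjoint_family_on B UNIV"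
      by (auto simp: disjoint_family_on_def A_def B_def)
    have AB: "A g = act_order g -` B g \<inter> space \<nu>" for g
    proof (intro equalityI subsetI)
      fix r assume "r \<in> A g"
      then show "r \<in> act_order g -` B g \<inter> space \<nu>"
        using order_enum_act_order[of r i "- i"] act_order_orders_Z
        by (auto simp: A_def B_def order_enum_0)
    next
      fix r assume r: "r \<in> act_order g -` B g \<inter> space \<nu>"
      then have r': "act_order g r \<in> orders_Z" "order_enum (act_order g r) (- i) = - g" "act_order g r \<in> b"
        by (auto simp: B_def)
      have "order_enum (act_order (- g) (act_order g r)) i = g"
        using order_enum_act_order[OF r'(1), of "- i" i] r' by (simp add: order_enum_0)
      then show "r \<in> A g"
        using r r' by (auto simp: A_def act_act)
    qed
    have [measurable]: "A g \<in> sets \<nu>" for g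
      unfolding AB by (rule measurable_sets[OF measurable_act]) simp
    have eq: "emeasure \<nu> (A g) = emeasure \<nu> (B g)" for g
    proof -
      have "emeasure \<nu> (A g) = emeasure (distr \<nu> \<nu> (act_order g)) (B g)"
        by (simp add: AB emeasure_distr)
      then show ?thesis
        using act_preserving[of g] by (simp add: measure_preserving_def)
    qed
    have "emeasure (distr \<nu> \<nu> (shift i)) b = emeasure \<nu> (\<Union>g. A g)"
    proof -
      have "shift i -` b \<inter> space \<nu> = (\<Union>g. A g)"
        by (auto simp: A_def shift_def)
      then show ?thesis by (simp add: emeasure_distr)
    qed
    also have "\<dots> = (\<integral>\<^sup>+g. emeasure \<nu> (A g) \<partial>count_space UNIV)"
      by (rule emeasure_UN_countable) (simp_all add: disj)
    also have "\<dots> = (\<integral>\<^sup>+g. emeasure \<nu> (B g) \<partial>count_space UNIV)"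
      by (simp add: eq)
    also have "\<dots> = emeasure \<nu> (\<Union>g. B g)"
      by (rule emeasure_UN_countable[symmetric]) (simp_all add: disj)
    also have "(\<Union>g. B g) = b"
    proof (intro equalityI subsetI)
      fix r assume r: "r \<in> b"
      then have "r \<in> B (- order_enum r (- i))"
        using sets.sets_into_space[OF b] by (auto simp: B_def)
      then show "r \<in> (\<Union>g. B g)" by blast
    qed (auto simp: B_def)
    finally show "emeasure (distr \<nu> \<nu> (shift i)) b = emeasure \<nu> b" .
  qed simp
qed (rule measurable_shift)

section \<open>Powers of the successor map along orbits\<close>

definition walk :: "int \<Rightarrow> 'x \<Rightarrow> 'x" where
  "walk i x = T (order_enum (\<phi> x) i) x"

lemma measurable_walk: "walk i \<in> measurable M M"
  unfolding walk_def[abs_def]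
  by (rule measurable_compose_countable[OF measurable_T measurable_compose[OF measurable_phi measurable_order_enum_nu]])

lemma successor_map_eq_walk: "successor_map T \<phi> = walk 1"
  by (simp add: fun_eq_iff successor_map_def walk_def)

definition regular :: "'x set" where
  "regular = {x \<in> space M. \<forall>g. \<phi> (T g x) = act_order g (\<phi> x)}"

lemma AE_regular: "AE x in M. x \<in> regular"
  using phi_equivariant AE_space by eventually_elim (simp add: regular_def)

text \<open>Regularity is asked of \<open>x\<close> alone: it identifies the order of
  \<open>walk i x\<close> as that of \<open>x\<close> recentred at its \<open>i\<close>-th element.
  The right translation in \<open>order_enum_shift\<close> is then cancelled by the action
  law.\<close>

lemma walk_walk:
  assumes x: "x \<in> regular"
  shows "walk j (walk i x) = walk (j + i) x"
proof -
  let ?r = "\<phi> x"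
  have r: "?r \<in> orders_Z" and xM: "x \<in> space M"
    using x by (auto simp: regular_def phi_orders_Z)
  have "\<phi> (walk i x) = shift i ?r"
    using x by (simp add: regular_def walk_def shift_def)
  then have "walk j (walk i x) = T (order_enum ?r (j + i) - order_enum ?r i) (T (order_enum ?r i) x)"
    by (subst walk_def) (simp add: order_enum_shift[OF r] walk_def)
  also have "\<dots> = walk (j + i) x"
    by (simp add: walk_def xM flip: T_add)
  finally show ?thesis .
qed

lemma walk_0: "x \<in> space M \<Longrightarrow> walk 0 x = x"
  by (simp add: walk_def order_enum_0 phi_orders_Z T_0)

text \<open>The inverse is an arbitrary choice, accessible only through its defining property;
  \<open>walk (- 1)\<close> is the witness that a choice exists.\<close>

lemma ae_inverse_walk:
  defines "S' \<equiv> ae_inverse M (walk 1)"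
  shows "S' \<in> measurable M M" "AE x in M. S' (walk 1 x) = x"
proof -
  have *: "AE x in M. walk i (walk j x) = x" if "i + j = 0" for i j
    using AE_regular
  proof eventually_elim
    case (elim x)
    then have "x \<in> space M" by (simp add: regular_def)
    with elim that show ?case by (simp add: walk_walk walk_0)
  qed
  have "\<exists>S'. S' \<in> measurable M M \<and> (AE x in M. S' (walk 1 x) = x) \<and> (AE x in M. walk 1 (S' x) = x)"
    by (intro exI[of _ "walk (- 1)"] conjI measurable_walk *) auto
  then have "S' \<in> measurable M M \<and> (AE x in M. S' (walk 1 x) = x) \<and> (AE x in M. walk 1 (S' x) = x)"
    unfolding S'_def ae_inverse_def by (rule someI_ex)
  then show "S' \<in> measurable M M" "AE x in M. S' (walk 1 x) = x"
    by auto
qed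

lemma measurable_iterates: "iterates M (walk 1) i \<in> measurable M M"
proof -
  have "f ^^ n \<in> measurable M M" if "f \<in> measurable M M" for f :: "'x \<Rightarrow> 'x" and n
    by (induction n) (auto intro!: measurable_compose[OF _ that])
  then show ?thesis
    using measurable_walk ae_inverse_walk(1) by (simp add: iterates_def)
qed

text \<open>A property that holds almost everywhere holds along whole orbits, by invariance and
  countability of the group. \<open>iterates_eq_walk\<close> needs this, since there the chosen
  inverse is applied at many points of the orbit of \<open>x\<close>.\<close>

lemma AE_all_T:
  assumes "AE x in M. Q x"
  shows "AE x in M. \<forall>g. Q (T g x)"
  unfolding AE_all_countable
proof
  fix g
  have "AE x in distr M M (T g). Q x"
  proof -
    have "distr M M (T g) = M"
      using T_preserving by (simp add: measure_preserving_def)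
    then show ?thesis
      using assms by (simp only:)
  qed
  then show "AE x in M. Q (T g x)"
    by (rule AE_distrD[OF measurable_T])
qed

lemma iterates_eq_walk: "AE x in M. \<forall>i. iterates M (walk 1) i x = walk i x"
proof -
  define S' where "S' = ae_inverse M (walk 1)"
  show ?thesis
    using AE_regular AE_all_T[OF ae_inverse_walk(2)]
  proof eventually_elim
    case (elim x)
    have x: "x \<in> space M"
      using elim by (simp add: regular_def)
    \<comment> \<open>The inverse relation is used at \<open>walk (i - 1) x\<close>, a point of the
      orbit of \<open>x\<close>, whose image under \<open>walk 1\<close> is
      \<open>walk i x\<close>.\<close>
    have S': "S' (walk i x) = walk (i - 1) x" for i
    proof -
      have "S' (walk 1 (walk (i - 1) x)) = walk (i - 1) x"
        using elim(2) by (auto simp: S'_def walk_def[of "i - 1"])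
      then show ?thesis
        using elim(1) by (simp add: walk_walk)
    qed
    have pos: "(walk 1 ^^ n) x = walk (int n) x" for n
      by (induction n) (use elim(1) x in \<open>auto simp: walk_0 walk_walk\<close>)
    have neg: "(S' ^^ n) x = walk (- int n) x" for n
    proof (induction n)
      case (Suc n)
      then show ?case
        using S'[of "- int n"] by (simp add: add.commute minus_diff_commute)
    qed (simp add: x walk_0)
    show ?case
    proof
      fix i
      show "iterates M (walk 1) i x = walk i x"
        using pos[of "nat i"] neg[of "nat (- i)"] unfolding S'_def iterates_def by simp
    qed
  qed
qed

text \<open>A finite piece of the same past as in \<open>past\<close>, but selected by positions in
  the order instead of by group elements. Position 0 is the unit, so the past consists of the
  negative positions.\<close>

definition past_Z :: "int set \<Rightarrow> ('g \<Rightarrow> 'g \<Rightarrow> bool) \<Rightarrow> 'g set" where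
  "past_Z L r = order_enum r ` {k\<in>L. k < 0}"

lemma past_Z_props:
  assumes "finite L"
  shows "r \<in> orders_Z \<Longrightarrow> finite (past_Z L r)" "Measurable.pred \<nu> (\<lambda>r. g \<in> past_Z L r)"
    "r \<in> orders_Z \<Longrightarrow> 0 \<notin> past_Z L r"
proof -
  have "(\<lambda>r. g \<in> past_Z L r) = (\<lambda>r. \<exists>k. k \<in> L \<and> k < 0 \<and> order_enum r k = g)"
    by (auto simp: past_Z_def)
  then show "Measurable.pred \<nu> (\<lambda>r. g \<in> past_Z L r)"
    by simp
  assume r: "r \<in> orders_Z"
  show "0 \<notin> past_Z L r"
  proof
    assume "0 \<in> past_Z L r"
    then obtain k where "0 = order_enum r k" "k \<in> {k \<in> L. k < 0}"
      unfolding past_Z_def by (rule imageE)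
    then show False
      using order_enum_eq_iff[OF r, of k 0] order_enum_0[OF r] by simp
  qed
qed (use assms in \<open>auto simp: past_Z_def\<close>)

definition gain_Z :: "int set \<Rightarrow> real" where
  "gain_Z L = (\<integral>r. incr r (past_Z L r) \<partial>\<nu>)"

text \<open>The iterates act by group elements that depend on \<open>x\<close>, but only through its
  order. Over the orders whose enumeration follows a given pattern \<open>a\<close> on
  \<open>D\<close> they are the fixed maps \<open>T (a i)\<close>, so \<open>cond_prob_cong\<close>
  applies; there are countably many patterns. The names along \<open>D\<close> thus become names
  over a random subset of the group.\<close>

lemma cells_iterates:
  assumes D: "finite D"
  shows "AE r in \<nu>. (\<Sum>w\<in>D \<rightarrow>\<^sub>E P. eta (cond_prob (cell (iterates M (walk 1)) D w) r)) =
    fib_ent r (order_enum r ` D)"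
proof -
  let ?I = "iterates M (walk 1)"
  have "AE r in \<nu>. \<forall>a\<in>D \<rightarrow>\<^sub>E UNIV. \<forall>w\<in>D \<rightarrow>\<^sub>E P. (\<forall>i\<in>D. order_enum r i = a i) \<longrightarrow>
      cond_prob (cell ?I D w) r = cond_prob (cell (\<lambda>i. T (a i)) D w) r"
  proof (rule AE_ball_countable')
    fix a :: "int \<Rightarrow> 'g"
    show "AE r in \<nu>. \<forall>w\<in>D \<rightarrow>\<^sub>E P. (\<forall>i\<in>D. order_enum r i = a i) \<longrightarrow>
      cond_prob (cell ?I D w) r = cond_prob (cell (\<lambda>i. T (a i)) D w) r"
    proof (rule AE_finite_allI)
      show "finite (D \<rightarrow>\<^sub>E P)"
        using D P_facts by (auto intro: finite_PiE)
      fix w assume w: "w \<in> D \<rightarrow>\<^sub>E P"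
      define c where "c = {r \<in> space \<nu>. \<forall>i\<in>D. order_enum r i = a i}"
      have "AE r in \<nu>. r \<in> c \<longrightarrow> cond_prob (cell ?I D w) r = cond_prob (cell (\<lambda>i. T (a i)) D w) r"
      proof (rule cond_prob_cong)
        show "cell ?I D w \<in> sets M" "cell (\<lambda>i. T (a i)) D w \<in> sets M"
          using w D measurable_iterates by (auto intro!: sets_cell)
        show "c \<in> sets \<nu>"
          unfolding c_def using D by (intro sets.sets_Collect_finite_All) measurable
        show "AE x in M. \<phi> x \<in> c \<longrightarrow> (x \<in> cell ?I D w \<longleftrightarrow> x \<in> cell (\<lambda>i. T (a i)) D w)"
          using iterates_eq_walk by eventually_elim (auto simp: c_def cell_def walk_def)
      qed
      then show "AE r in \<nu>. (\<forall>i\<in>D. order_enum r i = a i) \<longrightarrow>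
          cond_prob (cell ?I D w) r = cond_prob (cell (\<lambda>i. T (a i)) D w) r"
        using AE_space by eventually_elim (simp add: c_def)
    qed
  next
    show "countable (D \<rightarrow>\<^sub>E (UNIV :: 'g set))"
      using D by (intro countable_PiE) auto
  qed
  then show ?thesis
    using AE_space
  proof eventually_elim
    case (elim r)
    have r: "r \<in> orders_Z"
      using elim by simp
    have "(\<Sum>w\<in>D \<rightarrow>\<^sub>E P. eta (cond_prob (cell ?I D w) r)) =
        (\<Sum>w\<in>D \<rightarrow>\<^sub>E P. eta (cond_prob (cell (\<lambda>i. T (restrict (order_enum r) D i)) D w) r))"
    proof (intro sum.cong refl arg_cong[of _ _ eta])
      fix w assume "w \<in> D \<rightarrow>\<^sub>E P"
      moreover have "restrict (order_enum r) D \<in> D \<rightarrow>\<^sub>E UNIV"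
        by simp
      ultimately show "cond_prob (cell ?I D w) r = cond_prob (cell (\<lambda>i. T (restrict (order_enum r) D i)) D w) r"
        using elim(1) by (metis restrict_apply')
    qed
    also have "\<dots> = fib_ent r (restrict (order_enum r) D ` D)"
      unfolding fib_ent_def ent_def
      by (rule sum_cells_reindex[of _ _ "\<lambda>A. eta (cond_prob A r)"])
        (auto simp: inj_on_def order_enum_eq_iff[OF r])
    finally show ?case
      by simp
  qed
qed

lemma cond_entropy_walk:
  assumes D: "finite D" "D \<noteq> {}"
  shows "cond_partition_entropy M (orders_algebra M \<phi>) (iterated_partition M (iterates M (walk 1)) P D) =
    (\<Sum>i\<in>D. gain_Z ((\<lambda>d. d - i) ` D))"
proof -
  let ?L = "\<lambda>i. (\<lambda>d. d - i) ` D"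
  have L: "finite (?L i)" for i
    using D by simp
  have "cond_partition_entropy M (orders_algebra M \<phi>) (iterated_partition M (iterates M (walk 1)) P D) =
      (\<integral>r. (\<Sum>w\<in>D \<rightarrow>\<^sub>E P. eta (cond_prob (cell (iterates M (walk 1)) D w) r)) \<partial>\<nu>)"
    by (rule cond_entropy_iterated_partition[OF D measurable_iterates])
  also have "\<dots> = (\<integral>r. (\<Sum>i\<in>D. incr (shift i r) (past_Z (?L i) (shift i r))) \<partial>\<nu>)"
  proof (rule integral_cong_AE)
    show "(\<lambda>r. \<Sum>w\<in>D \<rightarrow>\<^sub>E P. eta (cond_prob (cell (iterates M (walk 1)) D w) r)) \<in> borel_measurable \<nu>"
      using D measurable_iterates
      by (intro borel_measurable_sum measurable_compose[OF measurable_cond_prob borel_measurable_eta] sets_cell)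
    show "(\<lambda>r. \<Sum>i\<in>D. incr (shift i r) (past_Z (?L i) (shift i r))) \<in> borel_measurable \<nu>"
      using past_Z_props[OF L]
      by (intro borel_measurable_sum borel_measurable_integrable incr_comp shift_preserving) auto
    show "AE r in \<nu>. (\<Sum>w\<in>D \<rightarrow>\<^sub>E P. eta (cond_prob (cell (iterates M (walk 1)) D w) r)) =
        (\<Sum>i\<in>D. incr (shift i r) (past_Z (?L i) (shift i r)))"
      using AE_good cells_iterates[OF D(1)]
    proof eventually_elim
      case (elim r)
      then have r: "r \<in> orders_Z"
        by (simp add: good_def)
      let ?D = "order_enum r ` D"
      \<comment> \<open>The enumeration is increasing, so the predecessors of the
        \<open>i\<close>-th element are the elements at positions \<open>d < i\<close>, that is, at
        positions \<open>d - i < 0\<close> of the recentred order.\<close>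
      have below: "{h \<in> ?D. r h (order_enum r i)} = (\<lambda>h. h + order_enum r i) ` past_Z (?L i) (shift i r)" for i
      proof -
        have "{k \<in> ?L i. k < 0} = (\<lambda>d. d - i) ` {d \<in> D. d < i}"
          by auto
        then have "(\<lambda>h. h + order_enum r i) ` past_Z (?L i) (shift i r) = order_enum r ` {d \<in> D. d < i}"
          by (simp add: past_Z_def image_image order_enum_shift[OF r])
        then show ?thesis
          by (auto simp: order_enum_less_iff[OF r])
      qed
      have step: "fib_ent r (insert (order_enum r i) {h\<in>?D. r h (order_enum r i)}) - fib_ent r {h\<in>?D. r h (order_enum r i)} =
          incr (shift i r) (past_Z (?L i) (shift i r))" for i
        unfolding below shift_def[of i r, symmetric]
        using fib_ent_increment[OF elim(1), of "past_Z (?L i) (shift i r)" "order_enum r i"]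
          past_Z_props(1)[OF L shift_orders_Z[OF r]] by (simp add: shift_def)
      have "fib_ent r ?D = (\<Sum>g\<in>?D. fib_ent r (insert g {h\<in>?D. r h g}) - fib_ent r {h\<in>?D. r h g})"
        using elim(1) D(1) by (intro fib_ent_chain) auto
      also have "\<dots> = (\<Sum>i\<in>D. incr (shift i r) (past_Z (?L i) (shift i r)))"
        by (subst sum.reindex) (auto simp: inj_on_def order_enum_eq_iff[OF r] step)
      finally show ?case
        using elim(2) by simp
    qed
  qed
  also have "\<dots> = (\<Sum>i\<in>D. \<integral>r. incr (shift i r) (past_Z (?L i) (shift i r)) \<partial>\<nu>)"
    using past_Z_props[OF L] by (intro Bochner_Integration.integral_sum incr_comp shift_preserving) auto
  also have "\<dots> = (\<Sum>i\<in>D. gain_Z (?L i))"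
    unfolding gain_Z_def using past_Z_props[OF L] by (intro sum.cong refl incr_comp shift_preserving) auto
  finally show ?thesis .
qed

subsection \<open>Comparison of the two chain rules\<close>

text \<open>Both increments decrease to limits. Each finite \<open>B n\<close> lies in some
  \<open>A m\<close> and conversely, so by antitonicity each limit is bounded by the other.\<close>

lemma incr_limits_agree:
  fixes A B :: "nat \<Rightarrow> 'g set"
  assumes r: "good r"
    and A: "incseq A" "\<And>n. finite (A n)" and B: "incseq B" "\<And>n. finite (B n)"
    and U: "(\<Union>n. A n) = (\<Union>n. B n)" "0 \<notin> (\<Union>n. A n)"
  shows "(\<lambda>n. incr r (A n) - incr r (B n)) \<longlonglongrightarrow> 0"
proof -
  have conv: "\<exists>l. (\<lambda>n. incr r (C n)) \<longlonglongrightarrow> l \<and> (\<forall>n. l \<le> incr r (C n))"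
    if C: "incseq C" "\<And>n. finite (C n)" "0 \<notin> (\<Union>n. C n)" for C
  proof -
    have "decseq (\<lambda>n. incr r (C n))"
      using C incr_antimono[OF r] by (auto simp: decseq_def incseq_def)
    then show ?thesis
      using incr_nonneg[OF r C(2)] decseq_convergent[of "\<lambda>n. incr r (C n)" 0] by metis
  qed
  have le: "l \<le> l'"
    if C: "(\<lambda>n. incr r (C n)) \<longlonglongrightarrow> l" "\<forall>n. l \<le> incr r (C n)" "incseq C" "\<And>n. finite (C n)"
      and C': "(\<lambda>n. incr r (C' n)) \<longlonglongrightarrow> l'" "\<And>n. finite (C' n)"
      and sub: "(\<Union>n. C' n) \<subseteq> (\<Union>n. C n)" "0 \<notin> (\<Union>n. C n)" for C C' :: "nat \<Rightarrow> 'g set" and l l'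
  proof (rule LIMSEQ_le_const[OF C'(1)], intro exI[of _ 0] allI impI)
    fix n
    obtain m where "C' n \<subseteq> C m"
      using finite_subset_incseq[OF C'(2)[of n] _ C(3)] sub by blast
    then have "incr r (C m) \<le> incr r (C' n)"
      using C(4) sub by (intro incr_antimono[OF r]) auto
    then show "l \<le> incr r (C' n)"
      using C(2) by (meson order_trans)
  qed
  obtain a where a: "(\<lambda>n. incr r (A n)) \<longlonglongrightarrow> a" "\<forall>n. a \<le> incr r (A n)"
    using conv[of A] A U by blast
  obtain b where b: "(\<lambda>n. incr r (B n)) \<longlonglongrightarrow> b" "\<forall>n. b \<le> incr r (B n)"
    using conv[of B] B U by auto
  have "a = b"
    using le[OF a A b(1) B(2)] le[OF b B a(1) A(2)] U by auto
  then show ?thesis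
    using tendsto_diff[OF a(1) b(1)] by simp
qed

lemma past_mono: "K \<subseteq> K' \<Longrightarrow> past K r \<subseteq> past K' r"
  by (auto simp: past_def)

lemma past_Z_mono: "L \<subseteq> L' \<Longrightarrow> past_Z L r \<subseteq> past_Z L' r"
  by (auto simp: past_Z_def)

lemma integral_incr_bounds:
  assumes "\<And>r. r \<in> orders_Z \<Longrightarrow> finite (D r)" "\<And>g. Measurable.pred \<nu> (\<lambda>r. g \<in> D r)"
    and "\<And>r. r \<in> orders_Z \<Longrightarrow> 0 \<notin> D r"
  shows "0 \<le> (\<integral>r. incr r (D r) \<partial>\<nu>)" "(\<integral>r. incr r (D r) \<partial>\<nu>) \<le> card P"
proof -
  have bounds: "AE r in \<nu>. 0 \<le> incr r (D r) \<and> incr r (D r) \<le> card P"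
    using AE_good
  proof eventually_elim
    case (elim r)
    then have "r \<in> orders_Z" by (simp add: good_def)
    with elim show ?case
      using assms incr_nonneg[of r "D r"] incr_le[of r "D r"] by simp
  qed
  show "0 \<le> (\<integral>r. incr r (D r) \<partial>\<nu>)"
  proof (rule integral_nonneg_AE)
    show "AE r in \<nu>. 0 \<le> incr r (D r)"
      using bounds by eventually_elim simp
  qed
  show "(\<integral>r. incr r (D r) \<partial>\<nu>) \<le> card P"
  proof (rule N.integral_le_const)
    show "integrable \<nu> (\<lambda>r. incr r (D r))"
      using assms by (rule integrable_incr)
    show "AE r in \<nu>. incr r (D r) \<le> card P"
      using bounds by eventually_elim simp
  qed
qed

lemma integral_incr_antimono:
  assumes "\<And>r. r \<in> orders_Z \<Longrightarrow> finite (D r)" "\<And>g. Measurable.pred \<nu> (\<lambda>r. g \<in> D r)"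
    and "\<And>r. r \<in> orders_Z \<Longrightarrow> 0 \<notin> D r"
    and "\<And>r. r \<in> orders_Z \<Longrightarrow> finite (D' r)" "\<And>g. Measurable.pred \<nu> (\<lambda>r. g \<in> D' r)"
    and "\<And>r. r \<in> orders_Z \<Longrightarrow> 0 \<notin> D' r"
    and sub: "\<And>r. r \<in> orders_Z \<Longrightarrow> D r \<subseteq> D' r"
  shows "(\<integral>r. incr r (D' r) \<partial>\<nu>) \<le> (\<integral>r. incr r (D r) \<partial>\<nu>)"
proof (rule integral_mono_AE)
  show "integrable \<nu> (\<lambda>r. incr r (D' r))" "integrable \<nu> (\<lambda>r. incr r (D r))"
    using assms by (auto intro!: integrable_incr)
  show "AE r in \<nu>. incr r (D' r) \<le> incr r (D r)"
    using AE_good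
  proof eventually_elim
    case (elim r)
    then have "r \<in> orders_Z" by (simp add: good_def)
    with elim show ?case
      using assms by (intro incr_antimono) auto
  qed
qed

lemma gain_antimono: "finite K' \<Longrightarrow> K \<subseteq> K' \<Longrightarrow> gain K' \<le> gain K"
  unfolding gain_def using past_props[of K] past_props[of K'] past_mono[of K K']
  by (intro integral_incr_antimono) (auto dest: finite_subset)

lemma gain_Z_antimono: "finite L' \<Longrightarrow> L \<subseteq> L' \<Longrightarrow> gain_Z L' \<le> gain_Z L"
  unfolding gain_Z_def using past_Z_props[of L] past_Z_props[of L'] past_Z_mono[of L L']
  by (intro integral_incr_antimono) (auto dest: finite_subset)

definition exhaustion :: "nat \<Rightarrow> 'g set" where
  "exhaustion n = {g. to_nat g \<le> n}"

lemma exhaustion: "finite (exhaustion n)" "incseq exhaustion" "(\<Union>n. exhaustion n) = UNIV"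
proof -
  have "inj_on to_nat (exhaustion n)" "to_nat ` exhaustion n \<subseteq> {..n}"
    by (auto simp: exhaustion_def inj_on_def)
  then show "finite (exhaustion n)"
    by (meson finite_atMost inj_on_finite)
qed (auto simp: exhaustion_def incseq_def)

text \<open>Windows of group elements and windows of positions exhaust the same past of the unit.
  The increments therefore have a common limit for almost every order, and the bound
  \<open>card P\<close> permits dominated convergence.\<close>

lemma gain_difference: "(\<lambda>n. gain (exhaustion n) - gain_Z {- int n..int n}) \<longlonglongrightarrow> 0"
proof -
  let ?L = "\<lambda>n. {- int n..int n}"
  let ?a = "\<lambda>n r. incr r (past (exhaustion n) r)" and ?b = "\<lambda>n r. incr r (past_Z (?L n) r)"
  have int: "integrable \<nu> (?a n)" "integrable \<nu> (?b n)" for n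
    using past_props[OF exhaustion(1)] past_Z_props[of "?L n"] by (auto intro!: integrable_incr)
  have "(\<lambda>n. \<integral>r. ?a n r - ?b n r \<partial>\<nu>) \<longlonglongrightarrow> (\<integral>r. 0 \<partial>\<nu>)"
  proof (rule integral_dominated_convergence[where w = "\<lambda>_. real (card P)"])
    show "(\<lambda>r. ?a n r - ?b n r) \<in> borel_measurable \<nu>" for n
      using int by (intro borel_measurable_diff borel_measurable_integrable)
    show "AE r in \<nu>. (\<lambda>n. ?a n r - ?b n r) \<longlonglongrightarrow> 0"
      using AE_good
    proof eventually_elim
      case (elim r)
      then have r: "r \<in> orders_Z" by (simp add: good_def)
      have a: "(\<Union>n. past (exhaustion n) r) = {g. r g 0}"
        using exhaustion(3) by (auto simp: past_def)
      \<comment> \<open>Here the order type matters: the enumeration is onto, so every predecessor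
        of the unit has a negative integer position.\<close>
      have b: "(\<Union>n. past_Z (?L n) r) = {g. r g 0}"
      proof (intro equalityI subsetI)
        fix g assume "g \<in> (\<Union>n. past_Z (?L n) r)"
        then obtain k where "g = order_enum r k" "k < 0"
          by (auto simp: past_Z_def)
        then show "g \<in> {g. r g 0}"
          using order_enum_less_iff[OF r, of k 0] by (simp add: order_enum_0[OF r])
      next
        fix g assume g: "g \<in> {g. r g 0}"
        obtain k where k: "order_enum r k = g"
          using order_enum_surj[OF r] .
        then have "k < 0"
          using g order_enum_less_iff[OF r, of k 0] by (simp add: order_enum_0[OF r])
        then have "g \<in> past_Z (?L (nat (- k))) r"
          using k by (auto simp: past_Z_def)
        then show "g \<in> (\<Union>n. past_Z (?L n) r)" by blast
      qed
      show ?case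
      proof (rule incr_limits_agree[OF elim])
        show "incseq (\<lambda>n. past (exhaustion n) r)"
          using exhaustion(2) by (auto simp: incseq_def intro!: past_mono)
        show "incseq (\<lambda>n. past_Z (?L n) r)"
          by (auto simp: incseq_def intro!: past_Z_mono)
      qed (use r exhaustion(1) past_props(1) past_Z_props(1) orders_ZD(1)[OF r] in \<open>auto simp: a b\<close>)
    qed
    show "AE r in \<nu>. norm (?a n r - ?b n r) \<le> real (card P)" for n
      using AE_good
    proof eventually_elim
      case (elim r)
      then have r: "r \<in> orders_Z" by (simp add: good_def)
      have "0 \<le> ?a n r" "?a n r \<le> card P" "0 \<le> ?b n r" "?b n r \<le> card P"
        using elim past_props[OF exhaustion(1)[of n]] past_Z_props[of "?L n"] r
        by (auto intro!: incr_nonneg incr_le)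
      then show ?case by simp
    qed
  qed simp_all
  moreover have "(\<integral>r. ?a n r - ?b n r \<partial>\<nu>) = gain (exhaustion n) - gain_Z (?L n)" for n
    unfolding gain_def gain_Z_def using int by (rule Bochner_Integration.integral_diff)
  ultimately show ?thesis by simp
qed

text \<open>On the group side \<open>gain\<close> is decreasing and nonnegative along the
  exhaustion, which produces \<open>h\<close>. By \<open>gain_difference\<close> the integer windows
  have the same limit, and \<open>folner_average\<close> carries it to all Folner sequences of
  either group.\<close>

theorem entropy_rate_limits:
  obtains h where
    "\<And>F. folner F \<Longrightarrow> (\<lambda>n. cond_partition_entropy M (orders_algebra M \<phi>)
      (iterated_partition M T P (F n)) / real (card (F n))) \<longlonglongrightarrow> h"
    "\<And>F. folner F \<Longrightarrow> (\<lambda>n. cond_partition_entropy M (orders_algebra M \<phi>)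
      (iterated_partition M (iterates M (walk 1)) P (F n)) / real (card (F n))) \<longlonglongrightarrow> h"
proof -
  have "decseq (\<lambda>n. gain (exhaustion n))"
    using gain_antimono exhaustion(1,2) by (auto simp: decseq_def incseq_def)
  moreover have "0 \<le> gain (exhaustion n)" for n
    unfolding gain_def using past_props[OF exhaustion(1)] by (intro integral_incr_bounds)
  ultimately obtain h where h: "(\<lambda>n. gain (exhaustion n)) \<longlonglongrightarrow> h"
    using decseq_convergent[of "\<lambda>n. gain (exhaustion n)" 0] by metis
  have h_Z: "(\<lambda>n. gain_Z {- int n..int n}) \<longlonglongrightarrow> h"
    using tendsto_diff[OF h gain_difference] by simp
  show ?thesis
  proof (rule that)
    fix F :: "nat \<Rightarrow> 'g set" assume F: "folner F"
    show "(\<lambda>n. cond_partition_entropy M (orders_algebra M \<phi>)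
      (iterated_partition M T P (F n)) / real (card (F n))) \<longlonglongrightarrow> h"
    proof (rule folner_average[OF F _ gain_antimono exhaustion h cond_entropy_T])
      show "gain K \<le> card P" if "finite K" for K
        unfolding gain_def using past_props[OF that] by (intro integral_incr_bounds)
    qed
  next
    fix F :: "nat \<Rightarrow> int set" assume F: "folner F"
    show "(\<lambda>n. cond_partition_entropy M (orders_algebra M \<phi>)
      (iterated_partition M (iterates M (walk 1)) P (F n)) / real (card (F n))) \<longlonglongrightarrow> h"
    proof (rule folner_average[where a = gain_Z and C = "card P", OF F _ _ _ _ _ h_Z cond_entropy_walk])
      show "gain_Z L' \<le> gain_Z L" if "finite L'" "L \<subseteq> L'" for L L'
        using that by (rule gain_Z_antimono)
      show "incseq (\<lambda>n. {- int n..int n})"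
        by (auto simp: incseq_def)
      show "gain_Z L \<le> card P" if "finite L" for L
        unfolding gain_Z_def using past_Z_props[OF that] by (intro integral_incr_bounds)
      show "(\<Union>n. {- int n..int n}) = UNIV"
      proof (intro equalityI subsetI)
        fix k :: int
        have "k \<in> {- int (nat \<bar>k\<bar>)..int (nat \<bar>k\<bar>)}"
          by auto
        then show "k \<in> (\<Union>n. {- int n..int n})" by blast
      qed simp
    qed simp
  qed
qed

end

text \<open>The sequence \<open>F0\<close> provides uniqueness: any competing value would be a limit
  of the same real sequence along \<open>F0\<close>.\<close>

lemma cond_entropy_rate_eqI:
  fixes F0 :: "nat \<Rightarrow> 'g::group_add set" and T :: "'g \<Rightarrow> 'x \<Rightarrow> 'x"
  assumes "folner F0"
    and "\<And>F. folner F \<Longrightarrow>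
      (\<lambda>n. cond_partition_entropy M \<Theta> (iterated_partition M T P (F n)) / real (card (F n))) \<longlonglongrightarrow> h"
  shows "cond_entropy_rate M T \<Theta> P = h"
  unfolding cond_entropy_rate_def
proof (rule the_equality)
  fix h' assume "\<forall>F. folner F \<longrightarrow>
    (\<lambda>n. cond_partition_entropy M \<Theta> (iterated_partition M T P (F n)) / real (card (F n))) \<longlonglongrightarrow> h'"
  with assms(1) have "(\<lambda>n. cond_partition_entropy M \<Theta> (iterated_partition M T P (F0 n)) / real (card (F0 n)))
      \<longlonglongrightarrow> h'"
    by simp
  then show "h' = h"
    using assms(2)[OF assms(1)] by (rule LIMSEQ_unique)
qed (simp add: assms(2))

theorem theorem5p1:
  fixes M :: "'x measure"
    and T :: "'g::{group_add, countable} \<Rightarrow> 'x \<Rightarrow> 'x"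
    and \<nu> :: "('g \<Rightarrow> 'g \<Rightarrow> bool) measure"
    and \<phi> :: "'x \<Rightarrow> 'g \<Rightarrow> 'g \<Rightarrow> bool"
    and P :: "'x set set"
  assumes "infinite (UNIV :: 'g set)"
    and "amenable TYPE('g)"
    and "standard_prob_space M"
    and "mp_action M T"
    and "multiorder \<nu>"
    and "factor_map M T \<nu> act_order \<phi>"
    and "finite_partition M M P"
  shows "cond_entropy_rate M T (orders_algebra M \<phi>) P =
         cond_entropy_rate M (iterates M (successor_map T \<phi>)) (orders_algebra M \<phi>) P"
proof -
  interpret multiordered M T \<nu> \<phi> P
    using assms by (intro multiordered.intro) (auto simp: standard_prob_space_def)
  obtain F0 :: "nat \<Rightarrow> 'g set" where F0: "folner F0"
    using assms(2) by (auto simp: amenable_def)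
  obtain h where h: "\<And>F. folner F \<Longrightarrow> (\<lambda>n. cond_partition_entropy M (orders_algebra M \<phi>)
      (iterated_partition M T P (F n)) / real (card (F n))) \<longlonglongrightarrow> h"
    "\<And>F. folner F \<Longrightarrow> (\<lambda>n. cond_partition_entropy M (orders_algebra M \<phi>)
      (iterated_partition M (iterates M (walk 1)) P (F n)) / real (card (F n))) \<longlonglongrightarrow> h"
    using entropy_rate_limits by blast
  show ?thesis
    unfolding successor_map_eq_walk
    using cond_entropy_rate_eqI[OF F0 h(1)] cond_entropy_rate_eqI[OF folner_int h(2)] by simp
qed

end
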